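(* Let $R$ be a commutative ring with unit, $\mathcal{P}_0=(P_0,\cdot,\{\,,\,\}_0)$ a Poisson $R$-algebra, $P_1$ a faithful $P_0$-(bi)module, $P=P_0\ltimes P_1$ the trivial extension algebra, and $A=\Omega^1_{P_0}\oplus P_1$ the direct sum of the $P_0$-modules $\Omega^1_{P_0}$ and $P_1$. There is a one-to-one correspondence between the sets of (i) (admissible) Poisson structures $\{\,,\,\}$ on $P$ satisfying $\mathrm{pr}_0\{f\oplus\eta,g\oplus\xi\}=\{f,g\}_0$ for all $f\oplus\eta,g\oplus\xi\in P$; (ii) Poisson triples of $P$; (iii) Lie algebroid structures $([\![\,,\,]\!],\varrho_{P_0}\circ\mathrm{proj}_0)$ on $A$ over $P_0$ satisfying $\mathrm{proj}_0[\![\alpha\oplus\eta,\beta\oplus\xi]\!]=[\![\alpha,\beta]\!]_{P_0}$ for all $\alpha\oplus\eta,\beta\oplus\xi\in A$.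
   Context: A Poisson structure on an associative commutative unital $R$-algebra is a Lie bracket $\{\,,\,\}$ on it satisfying the Leibniz rule $\{a,b\cdot c\}=\{a,b\}\cdot c+b\cdot\{a,c\}$; the algebra with such a bracket is a Poisson $R$-algebra. The trivial extension algebra $P=P_0\ltimes P_1$ is the $R$-module $P_0\oplus P_1$ with product $(f\oplus\eta)\cdot(g\oplus\xi)=fg\oplus(f\xi+g\eta)$, and $\mathrm{pr}_0:P\to P_0$ is the canonical projection. $\mathrm{Der}(P_0)$ is the $P_0$-module of derivations of $P_0$. $\Omega^1_{P_0}$ denotes the (free) $P_0$-submodule of $\mathrm{Der}(P_0)^*$ consisting of the kernel of the multiplication $P_0\otimes_R P_0\to P_0$, equipped with the $R$-derivation $d:P_0\to\Omega^1_{P_0}$, $df:=1_{P_0}\otimes_R f-f\otimes_R 1_{P_0}$; by construction $\Omega^1_{P_0}=\mathrm{span}_{P_0}\{df\mid f\in P_0\}$. For $\alpha\in\Omega^1_{P_0}$, $(d\alpha)(D_1,D_2):=D_1(\alpha(D_2))-D_2(\alpha(D_1))-\alpha(D_1\circ D_2-D_2\circ D_1)$ for $D_1,D_2\in\mathrm{Der}(P_0)$. The map $\varrho_{P_0}:\Omega^1_{P_0}\to\mathrm{Der}(P_0)$ is the $P_0$-module morphism with $\varrho_{P_0}(dh)=\{h,\cdot\}_0$, and the Lie bracket on $\Omega^1_{P_0}$ is $[\![\alpha,\beta]\!]_{P_0}:=(d\beta)(\varrho_{P_0}(\alpha),\cdot)-(d\alpha)(\varrho_{P_0}(\beta),\cdot)+d(\beta(\varrho_{P_0}(\alpha)))$;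 in particular $[\![df,dg]\!]_{P_0}=d\{f,g\}_0$. The triple $(\Omega^1_{P_0},[\![\,,\,]\!]_{P_0},\varrho_{P_0})$ is the Lie algebroid of the Poisson algebra $\mathcal{P}_0$. A Lie algebroid structure on a faithful $P_0$-module $A$ over $P_0$ is a pair $([\![\,,\,]\!],\varrho)$, where $[\![\,,\,]\!]$ is a Lie bracket on $A$ and $\varrho:A\to\mathrm{Der}(P_0)$ is a morphism of $P_0$-modules such that $[\![X,aY]\!]=a[\![X,Y]\!]+\varrho(X)(a)\,Y$ for all $a\in P_0$, $X,Y\in A$. Here $\mathrm{proj}_0:A=\Omega^1_{P_0}\oplus P_1\to\Omega^1_{P_0}$ is the canonical projection. A contravariant derivative on $P_1$ is an $R$-bilinear map $\mathcal{D}:\Omega^1_{P_0}\times P_1\to P_1$, $(\alpha,\eta)\mapsto\mathcal{D}_\alpha\eta$, with $\mathcal{D}_{f\alpha}\eta=f\mathcal{D}_\alpha\eta$ and $\mathcal{D}_\alpha(f\eta)=f\mathcal{D}_\alpha\eta+\varrho_{P_0}(\alpha)(f)\,\eta$ for $f\in P_0$. A Poisson triple of $P$ is a triple $([\,,\,]_1,\mathcal{D},\mathcal{K})$ consisting of a $P_0$-linear Lie bracket $[\,,\,]_1$ on $P_1$, a contravariant derivative $\mathcal{D}$ on $P_1$, and a $P_0$-linear (in each argument) skew-symmetric mapping $\mathcal{K}:\Omega^1_{P_0}\times\Omega^1_{P_0}\to P_1$ such that, with $\mathrm{ad}_\eta:=[\eta,\cdot]_1$, for all $\alpha,\beta,\gamma\in\Omega^1_{P_0}$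 and $\eta\in P_1$: (1) $\mathcal{D}_\alpha\circ\mathrm{ad}_\eta-\mathrm{ad}_\eta\circ\mathcal{D}_\alpha=\mathrm{ad}_{\mathcal{D}_\alpha\eta}$; (2) $\mathcal{D}_\alpha\circ\mathcal{D}_\beta-\mathcal{D}_\beta\circ\mathcal{D}_\alpha-\mathcal{D}_{[\![\alpha,\beta]\!]_{P_0}}=\mathrm{ad}_{\mathcal{K}(\alpha,\beta)}$; (3) the cyclic sum over $(\alpha,\beta,\gamma)$ of $\mathcal{D}_\alpha\mathcal{K}(\beta,\gamma)+\mathcal{K}(\alpha,[\![\beta,\gamma]\!]_{P_0})$ is zero.
   Formalization: Ω¹ is taken as the kernel of the multiplication P_0⊗P_0→P_0 modulo its square, since on the kernel itself d is not a derivation (in R[x], d(x²)≠2x dx); Ω¹ is not assumed free or embedded in Der(P_0)^*. *)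

theory Defs
  imports Complex_Main "HOL-Library.Poly_Mapping" "HOL-Library.Product_Plus" "HOL-Library.FuncSet"
begin

section \<open>Modules with an explicit carrier\<close>

text \<open>
  The ring \<open>R\<close>, the algebra \<open>P\<^sub>0\<close> and the module \<open>P\<^sub>1\<close> are types with scalar multiplications in the
  sense of the locale \<^locale>\<open>module\<close>. The module of differentials is a quotient that depends on
  these scalar multiplications, so it cannot be a type. The record below treats both cases uniformly.
\<close>

record ('k, 'v) modl =
  carrier :: "'v set"
  madd :: "'v \<Rightarrow> 'v \<Rightarrow> 'v"
  mzero :: 'v
  mscale :: "'k \<Rightarrow> 'v \<Rightarrow> 'v"

definition whole :: "('k \<Rightarrow> 'v \<Rightarrow> 'v) \<Rightarrow> ('k, 'v::ab_group_add) modl" where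
  "whole scale = \<lparr>carrier = UNIV, madd = (+), mzero = 0, mscale = scale\<rparr>"

definition direct_sum :: "('k, 'v) modl \<Rightarrow> ('k, 'w) modl \<Rightarrow> ('k, 'v \<times> 'w) modl" where
  "direct_sum M N =
    \<lparr>carrier = carrier M \<times> carrier N,
     madd = (\<lambda>x y. (madd M (fst x) (fst y), madd N (snd x) (snd y))),
     mzero = (mzero M, mzero N),
     mscale = (\<lambda>a x. (mscale M a (fst x), mscale N a (snd x)))\<rparr>"

text \<open>A \<open>P\<^sub>0\<close>-module as an \<open>R\<close>-module, where \<open>s\<close> is the \<open>R\<close>-scalar multiplication of \<open>P\<^sub>0\<close>.\<close>

definition restrict_scalars ::
  "('r \<Rightarrow> 'a::comm_ring_1 \<Rightarrow> 'a) \<Rightarrow> ('a, 'v) modl \<Rightarrow> ('r, 'v) modl" where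
  "restrict_scalars s M =
    \<lparr>carrier = carrier M, madd = madd M, mzero = mzero M, mscale = (\<lambda>r. mscale M (s r 1))\<rparr>"

definition faithful :: "('a::comm_ring_1, 'v) modl \<Rightarrow> bool" where
  "faithful M \<longleftrightarrow> (\<forall>a. (\<forall>x\<in>carrier M. mscale M a x = mzero M) \<longrightarrow> a = 0)"

definition linear_map :: "('k, 'v) modl \<Rightarrow> ('k, 'w) modl \<Rightarrow> ('v \<Rightarrow> 'w) \<Rightarrow> bool" where
  "linear_map M N f \<longleftrightarrow>
    f \<in> carrier M \<rightarrow> carrier N \<and>
    (\<forall>x\<in>carrier M. \<forall>y\<in>carrier M. f (madd M x y) = madd N (f x) (f y)) \<and>
    (\<forall>a. \<forall>x\<in>carrier M. f (mscale M a x) = mscale N a (f x))"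

text \<open>Maps are extensional, so that two bilinear maps that agree on the carriers are equal.\<close>

definition bilinear_map ::
  "('k, 'u) modl \<Rightarrow> ('k, 'v) modl \<Rightarrow> ('k, 'w) modl \<Rightarrow> ('u \<Rightarrow> 'v \<Rightarrow> 'w) \<Rightarrow> bool" where
  "bilinear_map M N L b \<longleftrightarrow>
    b \<in> carrier M \<rightarrow>\<^sub>E carrier N \<rightarrow>\<^sub>E carrier L \<and>
    (\<forall>x\<in>carrier M. linear_map N L (b x)) \<and>
    (\<forall>y\<in>carrier N. linear_map M L (\<lambda>x. b x y))"


section \<open>Lie brackets, Poisson structures, Lie algebroids\<close>

text \<open>
  If \<open>2\<close> is not invertible, then \<open>b x y = - b y x\<close> is weaker than \<open>b x x = 0\<close>, and both readings
  of skew-symmetry are in use for Lie brackets. The flag selects one of them: the weak reading for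
  \<^term>\<open>False\<close> and the strong (alternating) one for \<^term>\<open>True\<close>. The main theorem holds for both
  values, provided that the same reading is used for all brackets and for \<open>\<K>\<close>.
\<close>

definition skew_symmetric :: "bool \<Rightarrow> ('k, 'v) modl \<Rightarrow> ('k, 'w) modl \<Rightarrow> ('v \<Rightarrow> 'v \<Rightarrow> 'w) \<Rightarrow> bool" where
  "skew_symmetric alt M N b \<longleftrightarrow>
    (\<forall>x\<in>carrier M. \<forall>y\<in>carrier M. madd N (b x y) (b y x) = mzero N) \<and>
    (alt \<longrightarrow> (\<forall>x\<in>carrier M. b x x = mzero N))"

definition lie_bracket :: "bool \<Rightarrow> ('k, 'v) modl \<Rightarrow> ('v \<Rightarrow> 'v \<Rightarrow> 'v) \<Rightarrow> bool" where
  "lie_bracket alt M b \<longleftrightarrow>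
    bilinear_map M M M b \<and> skew_symmetric alt M M b \<and>
    (\<forall>x\<in>carrier M. \<forall>y\<in>carrier M. \<forall>z\<in>carrier M.
      madd M (b x (b y z)) (madd M (b y (b z x)) (b z (b x y))) = mzero M)"

definition poisson_structure ::
  "bool \<Rightarrow> ('r, 'p) modl \<Rightarrow> ('p \<Rightarrow> 'p \<Rightarrow> 'p) \<Rightarrow> ('p \<Rightarrow> 'p \<Rightarrow> 'p) \<Rightarrow> bool" where
  "poisson_structure alt P mult b \<longleftrightarrow>
    lie_bracket alt P b \<and>
    (\<forall>x\<in>carrier P. \<forall>y\<in>carrier P. \<forall>z\<in>carrier P.
      b x (mult y z) = madd P (mult (b x y) z) (mult y (b x z)))"

locale comm_algebra = module scale
  for scale :: "'r::comm_ring_1 \<Rightarrow> 'a::comm_ring_1 \<Rightarrow> 'a" +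
  assumes scale_mult_left: "scale r (a * b) = scale r a * b"

definition Der :: "('r \<Rightarrow> 'a \<Rightarrow> 'a) \<Rightarrow> ('a::comm_ring_1, 'a \<Rightarrow> 'a) modl" where
  "Der s =
    \<lparr>carrier = {X. linear_map (whole s) (whole s) X \<and> (\<forall>f g. X (f * g) = X f * g + f * X g)},
     madd = (\<lambda>X Y f. X f + Y f), mzero = (\<lambda>f. 0), mscale = (\<lambda>a X f. a * X f)\<rparr>"

definition lie_algebroid ::
  "bool \<Rightarrow> ('r \<Rightarrow> 'a::comm_ring_1 \<Rightarrow> 'a) \<Rightarrow> ('a, 'v) modl \<Rightarrow>
   ('v \<Rightarrow> 'v \<Rightarrow> 'v) \<Rightarrow> ('v \<Rightarrow> 'a \<Rightarrow> 'a) \<Rightarrow> bool" where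
  "lie_algebroid alt s A b \<rho> \<longleftrightarrow>
    faithful A \<and> lie_bracket alt (restrict_scalars s A) b \<and> linear_map A (Der s) \<rho> \<and>
    (\<forall>x\<in>carrier A. \<forall>y\<in>carrier A. \<forall>a.
      b x (mscale A a y) = madd A (mscale A a (b x y)) (mscale A (\<rho> x a) y))"


section \<open>The trivial extension algebra\<close>

definition triv_ext ::
  "('r \<Rightarrow> 'a::comm_ring_1 \<Rightarrow> 'a) \<Rightarrow> ('a \<Rightarrow> 'm::ab_group_add \<Rightarrow> 'm) \<Rightarrow> ('r, 'a \<times> 'm) modl" where
  "triv_ext s act = restrict_scalars s (direct_sum (whole (*)) (whole act))"

definition triv_ext_mult ::
  "('a::comm_ring_1 \<Rightarrow> 'm::ab_group_add \<Rightarrow> 'm) \<Rightarrow> 'a \<times> 'm \<Rightarrow> 'a \<times> 'm \<Rightarrow> 'a \<times> 'm" where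
  "triv_ext_mult act x y = (fst x * fst y, act (fst x) (snd y) + act (fst y) (snd x))"


section \<open>Differentials\<close>

text \<open>
  \<open>F\<close> denotes the free abelian group on \<open>P\<^sub>0 \<times> P\<^sub>0\<close> and \<open>N \<subseteq> F\<close> the subgroup generated by the
  bilinearity relations, so that \<open>P\<^sub>0 \<otimes>\<^sub>R P\<^sub>0 = F / N\<close>. The multiplication \<open>a \<otimes> b \<mapsto> a b\<close> has the
  kernel \<open>I / N\<close>. The map \<open>f \<mapsto> 1 \<otimes> f - f \<otimes> 1\<close> is a derivation only modulo the square of this
  kernel, hence \<open>\<Omega>\<close> is the quotient of the kernel by its square, with the left \<open>P\<^sub>0\<close>-action. In
  terms of \<open>F\<close> it is \<open>I / J\<close>, where \<open>J\<close> is generated by \<open>N\<close> and the products of elements of \<open>I\<close>.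
  No freeness or torsion-freeness of \<open>\<Omega>\<close> is assumed.
\<close>

type_synonym 'a tens = "'a \<times> 'a \<Rightarrow>\<^sub>0 int"

type_synonym 'a form = "'a tens set"

inductive_set subgroup_span :: "'g::ab_group_add set \<Rightarrow> 'g set" for S where
  zero: "0 \<in> subgroup_span S"
| base: "x \<in> S \<Longrightarrow> x \<in> subgroup_span S"
| diff: "x \<in> subgroup_span S \<Longrightarrow> y \<in> subgroup_span S \<Longrightarrow> x - y \<in> subgroup_span S"

definition tensor_rels :: "('r \<Rightarrow> 'a::comm_ring_1 \<Rightarrow> 'a) \<Rightarrow> 'a tens set" where
  "tensor_rels s =
    {frag_of (a + a', b) - frag_of (a, b) - frag_of (a', b) | a a' b. True} \<union>
    {frag_of (a, b + b') - frag_of (a, b) - frag_of (a, b') | a b b'. True} \<union>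
    {frag_of (s r a, b) - frag_of (a, s r b) | r a b. True}"

text \<open>The additive extension of a map on pure tensors to a ring; the analogue for maps into a free
  abelian group is \<^const>\<open>frag_extend\<close>.\<close>

definition ring_extend :: "('b \<Rightarrow> 'a::comm_ring_1) \<Rightarrow> ('b \<Rightarrow>\<^sub>0 int) \<Rightarrow> 'a" where
  "ring_extend h t = (\<Sum>p\<in>Poly_Mapping.keys t. of_int (Poly_Mapping.lookup t p) * h p)"

definition tens_mult :: "'a::comm_ring_1 tens \<Rightarrow> 'a tens \<Rightarrow> 'a tens" where
  "tens_mult t u =
    frag_extend (\<lambda>(a, b). frag_extend (\<lambda>(a', b'). frag_of (a * a', b * b')) u) t"

definition ker_mult :: "'a::comm_ring_1 tens set" where
  "ker_mult = {t. ring_extend (\<lambda>(a, b). a * b) t = 0}"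

definition ker_mult_sq :: "('r \<Rightarrow> 'a::comm_ring_1 \<Rightarrow> 'a) \<Rightarrow> 'a tens set" where
  "ker_mult_sq s =
    subgroup_span (tensor_rels s \<union> {tens_mult t u | t u. t \<in> ker_mult \<and> u \<in> ker_mult})"

definition cls :: "('r \<Rightarrow> 'a::comm_ring_1 \<Rightarrow> 'a) \<Rightarrow> 'a tens \<Rightarrow> 'a form" where
  "cls s t = {u. u - t \<in> ker_mult_sq s}"

definition rep :: "'a form \<Rightarrow> 'a tens" where
  "rep \<alpha> = (SOME t. t \<in> \<alpha>)"

definition lmult :: "'a::comm_ring_1 \<Rightarrow> 'a tens \<Rightarrow> 'a tens" where
  "lmult f = frag_extend (\<lambda>(a, b). frag_of (f * a, b))"

definition Omega :: "('r \<Rightarrow> 'a::comm_ring_1 \<Rightarrow> 'a) \<Rightarrow> ('a, 'a form) modl" where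
  "Omega s =
    \<lparr>carrier = cls s ` ker_mult,
     madd = (\<lambda>\<alpha> \<beta>. cls s (rep \<alpha> + rep \<beta>)),
     mzero = cls s 0,
     mscale = (\<lambda>f \<alpha>. cls s (lmult f (rep \<alpha>)))\<rparr>"

definition dtens :: "'a::comm_ring_1 \<Rightarrow> 'a tens" where
  "dtens f = frag_of (1, f) - frag_of (f, 1)"

definition kd :: "('r \<Rightarrow> 'a::comm_ring_1 \<Rightarrow> 'a) \<Rightarrow> 'a \<Rightarrow> 'a form" where
  "kd s f = cls s (dtens f)"

text \<open>The pairing \<open>\<alpha>(X)\<close> of \<open>\<Omega>\<close> with derivations, that is, the canonical map from \<open>\<Omega>\<close> to the dual
  of \<open>Der(P\<^sub>0)\<close>. It is determined by \<open>(f dg)(X) = f X(g)\<close>.\<close>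

definition form_eval :: "'a::comm_ring_1 form \<Rightarrow> ('a \<Rightarrow> 'a) \<Rightarrow> 'a" where
  "form_eval \<alpha> X = ring_extend (\<lambda>(a, b). a * X b) (rep \<alpha>)"

definition ext_d :: "'a::comm_ring_1 form \<Rightarrow> ('a \<Rightarrow> 'a) \<Rightarrow> ('a \<Rightarrow> 'a) \<Rightarrow> 'a" where
  "ext_d \<alpha> X Y =
    X (form_eval \<alpha> Y) - Y (form_eval \<alpha> X) - form_eval \<alpha> (\<lambda>f. X (Y f) - Y (X f))"

text \<open>
  The \<open>1\<close>-form \<open>(d\<alpha>)(X, \<cdot>)\<close> as an element of \<open>\<Omega>\<close>: for \<open>\<alpha> = \<Sum> a db\<close> one has \<open>d\<alpha> = \<Sum> da \<and> db\<close>,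
  so it is \<open>\<Sum> (X(a) db - X(b) da)\<close>. The lemma \<open>form_eval_contr_d\<close> below shows that its value at
  \<open>Y\<close> is \<^term>\<open>ext_d \<alpha> X Y\<close>; if \<open>\<Omega>\<close> embeds into the dual of \<open>Der(P\<^sub>0)\<close>, this determines it.
\<close>

definition contr_d :: "('r \<Rightarrow> 'a::comm_ring_1 \<Rightarrow> 'a) \<Rightarrow> 'a form \<Rightarrow> ('a \<Rightarrow> 'a) \<Rightarrow> 'a form" where
  "contr_d s \<alpha> X =
    cls s (frag_extend (\<lambda>(a, b). lmult (X a) (dtens b) - lmult (X b) (dtens a)) (rep \<alpha>))"

text \<open>The anchor is \<open>\<rho>(\<Sum> a dh) = \<Sum> a {h, \<cdot>}\<close>; its value at \<open>g\<close> pairs the form with \<open>{\<cdot>, g}\<close>.\<close>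

definition anchor :: "('a::comm_ring_1 \<Rightarrow> 'a \<Rightarrow> 'a) \<Rightarrow> 'a form \<Rightarrow> 'a \<Rightarrow> 'a" where
  "anchor br \<alpha> = (\<lambda>g. form_eval \<alpha> (\<lambda>h. br h g))"

definition form_bracket ::
  "('r \<Rightarrow> 'a::comm_ring_1 \<Rightarrow> 'a) \<Rightarrow> ('a \<Rightarrow> 'a \<Rightarrow> 'a) \<Rightarrow> 'a form \<Rightarrow> 'a form \<Rightarrow> 'a form" where
  "form_bracket s br \<alpha> \<beta> =
    madd (Omega s)
      (madd (Omega s)
        (contr_d s \<beta> (anchor br \<alpha>))
        (mscale (Omega s) (- 1) (contr_d s \<alpha> (anchor br \<beta>))))
      (kd s (form_eval \<beta> (anchor br \<alpha>)))"


section \<open>Poisson triples\<close>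

definition contravariant_derivative ::
  "('r \<Rightarrow> 'a::comm_ring_1 \<Rightarrow> 'a) \<Rightarrow> ('a \<Rightarrow> 'a \<Rightarrow> 'a) \<Rightarrow> ('a \<Rightarrow> 'm::ab_group_add \<Rightarrow> 'm) \<Rightarrow>
   ('a form \<Rightarrow> 'm \<Rightarrow> 'm) \<Rightarrow> bool" where
  "contravariant_derivative s br act D \<longleftrightarrow>
    bilinear_map (restrict_scalars s (Omega s)) (restrict_scalars s (whole act))
      (restrict_scalars s (whole act)) D \<and>
    (\<forall>\<alpha>\<in>carrier (Omega s). \<forall>f \<eta>.
      D (mscale (Omega s) f \<alpha>) \<eta> = act f (D \<alpha> \<eta>) \<and>
      D \<alpha> (act f \<eta>) = act f (D \<alpha> \<eta>) + act (anchor br \<alpha> f) \<eta>)"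

type_synonym ('a, 'm) triple =
  "('m \<Rightarrow> 'm \<Rightarrow> 'm) \<times> ('a form \<Rightarrow> 'm \<Rightarrow> 'm) \<times> ('a form \<Rightarrow> 'a form \<Rightarrow> 'm)"

definition poisson_triples ::
  "bool \<Rightarrow> ('r \<Rightarrow> 'a::comm_ring_1 \<Rightarrow> 'a) \<Rightarrow> ('a \<Rightarrow> 'a \<Rightarrow> 'a) \<Rightarrow>
   ('a \<Rightarrow> 'm::ab_group_add \<Rightarrow> 'm) \<Rightarrow> ('a, 'm) triple set" where
  "poisson_triples alt s br act =
    {(b, D, K).
      lie_bracket alt (whole act) b \<and>
      contravariant_derivative s br act D \<and>
      bilinear_map (Omega s) (Omega s) (whole act) K \<and>
      skew_symmetric alt (Omega s) (whole act) K \<and>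
      (\<forall>\<alpha>\<in>carrier (Omega s). \<forall>\<eta> \<xi>. D \<alpha> (b \<eta> \<xi>) - b \<eta> (D \<alpha> \<xi>) = b (D \<alpha> \<eta>) \<xi>) \<and>
      (\<forall>\<alpha>\<in>carrier (Omega s). \<forall>\<beta>\<in>carrier (Omega s). \<forall>\<xi>.
        D \<alpha> (D \<beta> \<xi>) - D \<beta> (D \<alpha> \<xi>) - D (form_bracket s br \<alpha> \<beta>) \<xi> = b (K \<alpha> \<beta>) \<xi>) \<and>
      (\<forall>\<alpha>\<in>carrier (Omega s). \<forall>\<beta>\<in>carrier (Omega s). \<forall>\<gamma>\<in>carrier (Omega s).
        (D \<alpha> (K \<beta> \<gamma>) + K \<alpha> (form_bracket s br \<beta> \<gamma>)) +
        (D \<beta> (K \<gamma> \<alpha>) + K \<beta> (form_bracket s br \<gamma> \<alpha>)) +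
        (D \<gamma> (K \<alpha> \<beta>) + K \<gamma> (form_bracket s br \<alpha> \<beta>)) = 0)}"


section \<open>The three sets and the correspondences\<close>

definition ext_poisson_structures ::
  "bool \<Rightarrow> ('r \<Rightarrow> 'a::comm_ring_1 \<Rightarrow> 'a) \<Rightarrow> ('a \<Rightarrow> 'a \<Rightarrow> 'a) \<Rightarrow>
   ('a \<Rightarrow> 'm::ab_group_add \<Rightarrow> 'm) \<Rightarrow> ('a \<times> 'm \<Rightarrow> 'a \<times> 'm \<Rightarrow> 'a \<times> 'm) set" where
  "ext_poisson_structures alt s br act =
    {b. poisson_structure alt (triv_ext s act) (triv_ext_mult act) b \<and>
        (\<forall>f \<eta> g \<xi>. fst (b (f, \<eta>) (g, \<xi>)) = br f g)}"

definition algebroid_module ::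
  "('r \<Rightarrow> 'a::comm_ring_1 \<Rightarrow> 'a) \<Rightarrow> ('a \<Rightarrow> 'm::ab_group_add \<Rightarrow> 'm) \<Rightarrow> ('a, 'a form \<times> 'm) modl" where
  "algebroid_module s act = direct_sum (Omega s) (whole act)"

definition ext_lie_algebroids ::
  "bool \<Rightarrow> ('r \<Rightarrow> 'a::comm_ring_1 \<Rightarrow> 'a) \<Rightarrow> ('a \<Rightarrow> 'a \<Rightarrow> 'a) \<Rightarrow> ('a \<Rightarrow> 'm::ab_group_add \<Rightarrow> 'm) \<Rightarrow>
   (('a form \<times> 'm \<Rightarrow> 'a form \<times> 'm \<Rightarrow> 'a form \<times> 'm) \<times> ('a form \<times> 'm \<Rightarrow> 'a \<Rightarrow> 'a)) set" where
  "ext_lie_algebroids alt s br act =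
    {(b, \<rho>). lie_algebroid alt s (algebroid_module s act) b \<rho> \<and> \<rho> = anchor br \<circ> fst \<and>
      (\<forall>\<alpha>\<in>carrier (Omega s). \<forall>\<beta>\<in>carrier (Omega s). \<forall>\<eta> \<xi>.
        fst (b (\<alpha>, \<eta>) (\<beta>, \<xi>)) = form_bracket s br \<alpha> \<beta>)}"

definition poisson_of_triple ::
  "('r \<Rightarrow> 'a::comm_ring_1 \<Rightarrow> 'a) \<Rightarrow> ('a \<Rightarrow> 'a \<Rightarrow> 'a) \<Rightarrow> ('a, 'm::ab_group_add) triple \<Rightarrow>
   'a \<times> 'm \<Rightarrow> 'a \<times> 'm \<Rightarrow> 'a \<times> 'm" where
  "poisson_of_triple s br = (\<lambda>(b, D, K) (f, \<eta>) (g, \<xi>).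
    (br f g, D (kd s f) \<xi> - D (kd s g) \<eta> + K (kd s f) (kd s g) + b \<eta> \<xi>))"

definition algebroid_of_triple ::
  "('r \<Rightarrow> 'a::comm_ring_1 \<Rightarrow> 'a) \<Rightarrow> ('a \<Rightarrow> 'a \<Rightarrow> 'a) \<Rightarrow> ('a \<Rightarrow> 'm::ab_group_add \<Rightarrow> 'm) \<Rightarrow>
   ('a, 'm) triple \<Rightarrow>
   ('a form \<times> 'm \<Rightarrow> 'a form \<times> 'm \<Rightarrow> 'a form \<times> 'm) \<times> ('a form \<times> 'm \<Rightarrow> 'a \<Rightarrow> 'a)" where
  "algebroid_of_triple s br act = (\<lambda>(b, D, K).
    (\<lambda>x\<in>carrier (algebroid_module s act). \<lambda>y\<in>carrier (algebroid_module s act).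
       (form_bracket s br (fst x) (fst y),
        D (fst x) (snd y) - D (fst y) (snd x) + K (fst x) (fst y) + b (snd x) (snd y)),
     anchor br \<circ> fst))"


section \<open>Compatibility of the definitions with the pairing\<close>

lemma ring_extend_diff: "ring_extend h (t - u) = ring_extend h t - ring_extend h u"
proof -
  let ?A = "Poly_Mapping.keys t \<union> Poly_Mapping.keys u"
  have *: "ring_extend h v = (\<Sum>p\<in>?A. of_int (Poly_Mapping.lookup v p) * h p)"
    if "Poly_Mapping.keys v \<subseteq> ?A" for v
    unfolding ring_extend_def using that
    by (intro sum.mono_neutral_left) (auto simp: in_keys_iff)
  show ?thesis
    by (simp add: * keys_diff lookup_minus algebra_simps sum_subtractf)
qed

lemma ring_extend_of [simp]: "ring_extend h (frag_of p) = h p"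
  by (simp add: ring_extend_def)

lemma ring_extend_zero [simp]: "ring_extend h 0 = 0"
  by (simp add: ring_extend_def)

lemma ring_extend_frag_extend:
  "ring_extend h (frag_extend k t) = ring_extend (\<lambda>p. ring_extend h (k p)) t"
  using subset_UNIV [of "Poly_Mapping.keys t"]
  by (induction t rule: frag_induction [where S = UNIV])
    (simp_all add: frag_extend_diff ring_extend_diff)

lemma ring_extend_tens_mult:
  "ring_extend h (tens_mult t u) =
    ring_extend (\<lambda>p. ring_extend (\<lambda>q. h (fst p * fst q, snd p * snd q)) u) t"
  by (simp add: tens_mult_def ring_extend_frag_extend split_def)

lemma ring_extend_cong: "(\<And>p. h p = k p) \<Longrightarrow> ring_extend h t = ring_extend k t"
  by (simp add: ring_extend_def)

lemma ring_extend_add: "ring_extend (\<lambda>p. h p + k p) t = ring_extend h t + ring_extend k t"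
  by (simp add: ring_extend_def algebra_simps sum.distrib)

lemma ring_extend_minus: "ring_extend (\<lambda>p. h p - k p) t = ring_extend h t - ring_extend k t"
  by (simp add: ring_extend_def algebra_simps sum_subtractf)

lemma ring_extend_mult: "ring_extend (\<lambda>p. c * h p) t = c * ring_extend h t"
  by (simp add: ring_extend_def sum_distrib_left mult_ac)

lemma ring_extend_additive:
  assumes "\<And>x y. X (x + y) = X x + X y"
  shows "X (ring_extend h t) = ring_extend (\<lambda>p. X (h p)) t"
proof -
  interpret additive X by (rule additive.intro) (rule assms)
  show ?thesis
    using subset_UNIV [of "Poly_Mapping.keys t"]
    by (induction t rule: frag_induction [where S = UNIV])
      (auto simp: zero ring_extend_diff diff)
qed

lemma derivation_additive: "X \<in> carrier (Der s) \<Longrightarrow> X (f + g) = X f + X g"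
  by (simp add: Der_def linear_map_def whole_def)

lemma derivation_scale: "X \<in> carrier (Der s) \<Longrightarrow> X (s r f) = s r (X f)"
  by (simp add: Der_def linear_map_def whole_def)

lemma derivation_mult: "X \<in> carrier (Der s) \<Longrightarrow> X (f * g) = X f * g + f * X g"
  by (simp add: Der_def)

lemma derivation_one: "X \<in> carrier (Der s) \<Longrightarrow> X 1 = 0"
  using derivation_mult [of X s 1 1] by simp

lemma derivation_commutator:
  assumes "X \<in> carrier (Der s)" "Y \<in> carrier (Der s)" "module s"
  shows "(\<lambda>f. X (Y f) - Y (X f)) \<in> carrier (Der s)"
proof -
  interpret module s by fact
  show ?thesis
    using assms(1,2)
    by (auto simp: Der_def linear_map_def whole_def algebra_simps)
qed

lemma ring_extend_ker_mult_sq: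
  assumes s: "comm_algebra s" and X: "X \<in> carrier (Der s)" and t: "t \<in> ker_mult_sq s"
  shows "ring_extend (\<lambda>(a, b). a * X b) t = 0"
proof -
  interpret comm_algebra s by fact
  note X' = derivation_additive [OF X] derivation_mult [OF X] derivation_scale [OF X]
  have scale: "s r a * b = a * s r b" for r a b
    by (metis scale_mult_left mult.commute)
  have prod: "ring_extend (\<lambda>(a, b). a * X b) (tens_mult u v) = 0"
    if u: "u \<in> ker_mult" and v: "v \<in> ker_mult" for u v
  proof -
    let ?m = "ring_extend (\<lambda>(a, b). a * b)" and ?e = "ring_extend (\<lambda>(a, b). a * X b)"
    have inner: "ring_extend (\<lambda>q. fst p * fst q * X (snd p * snd q)) v
        = fst p * X (snd p) * ?m v + fst p * snd p * ?e v" for p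
      by (simp add: X' split_def algebra_simps
          flip: ring_extend_mult ring_extend_add)
    have "?e (tens_mult u v) = ring_extend (\<lambda>p. ?e v * (fst p * snd p)) u"
      using v by (simp add: ring_extend_tens_mult inner ker_mult_def mult.commute)
    also have "\<dots> = ?e v * ?m u"
      by (simp add: ring_extend_mult split_def)
    finally show ?thesis using u by (simp add: ker_mult_def)
  qed
  show ?thesis
    using t unfolding ker_mult_sq_def
  proof (induction rule: subgroup_span.induct)
    case (base t)
    then show ?case
      by (auto simp: tensor_rels_def ring_extend_diff X' prod scale distrib_left distrib_right)
  qed (simp_all add: ring_extend_diff)
qed

lemma rep_cls: "rep (cls s t) - t \<in> ker_mult_sq s"
proof -
  have "t \<in> cls s t" by (simp add: cls_def ker_mult_sq_def subgroup_span.zero)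
  then have "rep (cls s t) \<in> cls s t" unfolding rep_def by (rule someI)
  then show ?thesis by (simp add: cls_def)
qed

lemma form_eval_cls:
  assumes "comm_algebra s" "X \<in> carrier (Der s)"
  shows "form_eval (cls s t) X = ring_extend (\<lambda>(a, b). a * X b) t"
  using ring_extend_ker_mult_sq [OF assms rep_cls [of s t]]
  by (simp add: form_eval_def ring_extend_diff)

lemma form_eval_kd:
  assumes "comm_algebra s" "X \<in> carrier (Der s)"
  shows "form_eval (kd s f) X = X f"
  using assms
  by (simp add: kd_def form_eval_cls dtens_def ring_extend_diff derivation_one)

lemma form_eval_contr_d:
  assumes s: "comm_algebra s" and X: "X \<in> carrier (Der s)" and Y: "Y \<in> carrier (Der s)"
  shows "form_eval (contr_d s \<alpha> X) Y = ext_d \<alpha> X Y"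
proof -
  interpret comm_algebra s by fact
  have l: "ring_extend (\<lambda>(a, b). a * Y b) (lmult f (dtens g)) = f * Y g" for f g
    by (simp add: lmult_def dtens_def ring_extend_frag_extend ring_extend_diff split_def
        derivation_one [OF Y])
  have "form_eval (contr_d s \<alpha> X) Y = ring_extend (\<lambda>(a, b). X a * Y b - X b * Y a) (rep \<alpha>)"
    by (simp add: contr_d_def form_eval_cls [OF s Y] ring_extend_frag_extend split_def
        ring_extend_diff l [unfolded split_def])
  also have "\<dots> = ext_d \<alpha> X Y"
    unfolding ext_d_def form_eval_def
      ring_extend_additive [of X, OF derivation_additive [OF X]]
      ring_extend_additive [of Y, OF derivation_additive [OF Y]]
      ring_extend_minus [symmetric]
    by (rule ring_extend_cong)
      (simp add: split_def derivation_mult [OF X] derivation_mult [OF Y] algebra_simps)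
  finally show ?thesis .
qed

lemma anchor_kd:
  assumes s: "comm_algebra s" and br: "poisson_structure alt (whole s) (*) br"
  shows "anchor br (kd s h) = br h"
proof -
  have skew: "br f g = - br g f" for f g
    using br by (simp add: poisson_structure_def lie_bracket_def skew_symmetric_def whole_def
        eq_neg_iff_add_eq_0)
  have leib: "br f (g * h) = br f g * h + g * br f h" for f g h
    using br by (simp add: poisson_structure_def whole_def)
  have "(\<lambda>h. br h g) \<in> carrier (Der s)" for g
  proof -
    have "linear_map (whole s) (whole s) (\<lambda>h. br h g)"
      using br by (simp add: poisson_structure_def lie_bracket_def bilinear_map_def whole_def)
    moreover have "br (f * h) g = br f g * h + f * br h g" for f h
      using leib [of g f h] skew [of "f * h" g] skew [of f g] skew [of h g] by simp
    ultimately show ?thesis by (simp add: Der_def)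
  qed
  then show ?thesis
    by (simp add: anchor_def form_eval_kd [OF s] fun_eq_iff)
qed

end

theory Submission
  imports Defs
begin

text \<open>
  A Poisson bracket on \<open>P\<^sub>0 \<ltimes> P\<^sub>1\<close> over \<open>{,}\<^sub>0\<close> and a Lie algebroid bracket on \<open>\<Omega> \<oplus> P\<^sub>1\<close> over the
  bracket of \<open>\<Omega>\<close> both have the \<open>P\<^sub>1\<close>-component \<open>D x \<xi> - D y \<eta> + K x y + [\<eta>, \<xi>]\<close>, with \<open>x, y\<close> in
  \<open>P\<^sub>0\<close> and in \<open>\<Omega>\<close>, respectively. Evaluating the Jacobi identity on elements of the two summands
  separates it into the Jacobi identity of \<open>[,]\<close> and the conditions (1)--(3) of a Poisson triple.
  For the algebroid this already is the correspondence. For the Poisson bracket, the Leibniz rule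
  makes \<open>D\<close> and \<open>K\<close> derivations in their \<open>P\<^sub>0\<close>-arguments, which extend uniquely to \<open>\<Omega>\<close> by its
  universal property. Conditions (1)--(3) are tensorial, so it suffices to have them on exact forms.
\<close>


section \<open>Free abelian groups and the action on tensors\<close>

text \<open>\<open>P_0\<close> is arbitrary, so \<Omega> may have torsion and need not embed into
  the dual of \<open>Der(P_0)\<close>. Hence forms cannot be compared by their values on
  derivations. Two other means replace evaluation: \<Omega> is generated by the exact forms
  \<open>d f\<close>, so an identity whose Leibniz terms cancel has to be verified only there; and a
  map out of \<Omega> is obtained from a derivation on \<open>P_0\<close>. Both already enter into
  the Lie bracket of \<Omega>, whose Jacobi identity is derived and not assumed. As 2 need not be
  invertible, skew-symmetry does not yield \<open>b x x = 0\<close>. The alternating law is carried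
  along separately when the flag asks for it; it passes from exact forms to all forms because the
  cross terms cancel by skewness.\<close>

lemma frag_induct [case_names zero of diff]:
  assumes "P 0" "\<And>p. P (frag_of p)" "\<And>t u. P t \<Longrightarrow> P u \<Longrightarrow> P (t - u)"
  shows "P t"
  using subset_UNIV [of "Poly_Mapping.keys t"]
  by (induction t rule: frag_induction [where S = UNIV]) (auto intro: assms)

lemma frag_extend_fun_diff:
  "frag_extend (\<lambda>p. h p - k p) t = frag_extend h t - frag_extend k t"
  by (induction t rule: frag_induct) (simp_all add: frag_extend_diff)

lemma tens_mult_of [simp]: "tens_mult (frag_of (a, b)) (frag_of (c, d)) = frag_of (a * c, b * d)"
  by (simp add: tens_mult_def)

lemma tens_mult_zero [simp]: "tens_mult 0 u = 0" "tens_mult t 0 = 0"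
  unfolding tens_mult_def by (simp, induction t rule: frag_induct) (simp_all add: frag_extend_diff)

lemma tens_mult_diff:
  "tens_mult (t - t') u = tens_mult t u - tens_mult t' u"
  "tens_mult t (u - u') = tens_mult t u - tens_mult t u'"
  by (simp_all add: tens_mult_def frag_extend_diff split_def frag_extend_fun_diff)

lemma lmult_of [simp]: "lmult f (frag_of (a, b)) = frag_of (f * a, b)"
  by (simp add: lmult_def)

lemma lmult_zero [simp]: "lmult f 0 = 0"
  by (simp add: lmult_def)

lemma lmult_diff: "lmult f (t - u) = lmult f t - lmult f u"
  by (simp add: lmult_def frag_extend_diff)

lemma lmult_add: "lmult f (t + u) = lmult f t + lmult f u"
  by (simp add: lmult_def frag_extend_add)

lemma lmult_lmult: "lmult f (lmult g t) = lmult (f * g) t"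
  by (induction t rule: frag_induct) (auto simp: lmult_diff mult.assoc)

lemma lmult_one: "lmult 1 t = t"
  by (induction t rule: frag_induct) (auto simp: lmult_diff)

lemma lmult_tens_mult: "lmult f (tens_mult t u) = tens_mult (lmult f t) u"
proof (induction t rule: frag_induct)
  case (of p)
  show ?case
    by (induction u rule: frag_induct) (cases p; auto simp: lmult_diff tens_mult_diff mult.assoc)+
qed (simp_all add: lmult_diff tens_mult_diff)

text \<open>Kept general in \<open>h\<close>: the identity makes \<open>ker_mult\<close> stable
  under the left action, and a derivation makes the pairing of forms with it
  \<open>P_0\<close>-linear.\<close>

lemma ring_extend_lmult:
  "ring_extend (\<lambda>(a, b). a * h b) (lmult f t) = f * ring_extend (\<lambda>(a, b). a * h b) t"
  by (induction t rule: frag_induct) (auto simp: lmult_diff ring_extend_diff right_diff_distrib mult.assoc)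

lemma ker_mult_zero [simp]: "0 \<in> ker_mult"
  by (simp add: ker_mult_def)

lemma ker_mult_diff: "t \<in> ker_mult \<Longrightarrow> u \<in> ker_mult \<Longrightarrow> t - u \<in> ker_mult"
  by (simp add: ker_mult_def ring_extend_diff)

lemma ker_mult_add: "t \<in> ker_mult \<Longrightarrow> u \<in> ker_mult \<Longrightarrow> t + u \<in> ker_mult"
  using ker_mult_diff [of t "0 - u"] ker_mult_diff [of 0 u] by simp

lemma ker_mult_lmult: "t \<in> ker_mult \<Longrightarrow> lmult f t \<in> ker_mult"
  using ring_extend_lmult [of "\<lambda>b. b" f t] by (simp add: ker_mult_def)

lemma ker_mult_dtens [simp]: "dtens f \<in> ker_mult"
  by (simp add: ker_mult_def dtens_def ring_extend_diff)

lemma ker_mult_sq_zero: "0 \<in> ker_mult_sq s"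
  by (simp add: ker_mult_sq_def subgroup_span.zero)

lemma ker_mult_sq_diff: "t \<in> ker_mult_sq s \<Longrightarrow> u \<in> ker_mult_sq s \<Longrightarrow> t - u \<in> ker_mult_sq s"
  by (simp add: ker_mult_sq_def subgroup_span.diff)

lemma ker_mult_sq_minus: "t - u \<in> ker_mult_sq s \<Longrightarrow> u - t \<in> ker_mult_sq s"
  using ker_mult_sq_diff [of 0 s "t - u"] by (simp add: ker_mult_sq_zero)

lemma ker_mult_sq_trans:
  "t - u \<in> ker_mult_sq s \<Longrightarrow> u - v \<in> ker_mult_sq s \<Longrightarrow> t - v \<in> ker_mult_sq s"
  using ker_mult_sq_diff [of "t - u" s "v - u"] by (simp add: ker_mult_sq_minus)

lemma cls_eq_iff: "cls s t = cls s u \<longleftrightarrow> t - u \<in> ker_mult_sq s"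
  by (auto simp: cls_def set_eq_iff ker_mult_sq_zero
      intro: ker_mult_sq_trans ker_mult_sq_minus dest: spec [of _ t])

text \<open>Generators go to generators: \<open>f * scale r a = scale r (f * a)\<close> preserves
  the relations, and in a product of kernel elements \<open>f\<close> is absorbed by the left
  factor, which stays in the kernel.\<close>

lemma (in comm_algebra) ker_mult_sq_lmult:
  assumes "t \<in> ker_mult_sq scale"
  shows "lmult f t \<in> ker_mult_sq scale"
  using assms unfolding ker_mult_sq_def
proof (induction rule: subgroup_span.induct)
  case (base t)
  have "f * scale r a = scale r (f * a)" for r a
    by (metis scale_mult_left mult.commute)
  with base show ?case
    by (intro subgroup_span.base)
      (fastforce simp: tensor_rels_def lmult_diff lmult_tens_mult distrib_left
        intro: ker_mult_lmult)
qed (simp_all add: lmult_diff subgroup_span.zero subgroup_span.diff)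


section \<open>A module type containing the differentials\<close>

text \<open>
  \<open>\<Omega>\<close> is a set that depends on \<open>s\<close>. So that module laws hold without carrier premises, it is embedded
  into one type of class \<^class>\<open>ab_group_add\<close>, independent of \<open>s\<close>: the product of the quotients \<open>F / N\<close> over all subgroups \<open>N \<subseteq> F\<close>
  for which \<open>F / N\<close> is a \<open>P\<^sub>0\<close>-module.
\<close>

definition lmult_submodule :: "'a::comm_ring_1 tens set \<Rightarrow> bool" where
  "lmult_submodule N \<longleftrightarrow>
    0 \<in> N \<and> (\<forall>x\<in>N. \<forall>y\<in>N. x - y \<in> N) \<and> (\<forall>f. \<forall>x\<in>N. lmult f x \<in> N) \<and>
    (\<forall>a a' b. frag_of (a + a', b) - frag_of (a, b) - frag_of (a', b) \<in> N)"

lemma lmult_submoduleD: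
  assumes "lmult_submodule N"
  shows "0 \<in> N" "x \<in> N \<Longrightarrow> y \<in> N \<Longrightarrow> x - y \<in> N" "x \<in> N \<Longrightarrow> lmult f x \<in> N"
    "x \<in> N \<Longrightarrow> - x \<in> N" "x \<in> N \<Longrightarrow> y \<in> N \<Longrightarrow> x + y \<in> N"
proof -
  show "0 \<in> N" and diff: "\<And>x y. x \<in> N \<Longrightarrow> y \<in> N \<Longrightarrow> x - y \<in> N" and "x \<in> N \<Longrightarrow> lmult f x \<in> N"
    using assms by (auto simp: lmult_submodule_def)
  then show minus: "x \<in> N \<Longrightarrow> - x \<in> N" for x
    using diff [of 0 x] by simp
  show "x \<in> N \<Longrightarrow> y \<in> N \<Longrightarrow> x + y \<in> N"
    using diff [of x "- y"] minus by simp
qed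

text \<open>In the free group the action is not additive in the scalar, since
  \<open>(f + g) a \<otimes> b\<close> is a generator of its own. The left additivity relations in
  \<open>lmult_submodule\<close> repair this modulo \<open>N\<close>.\<close>

lemma lmult_submodule_add_left:
  assumes "lmult_submodule N"
  shows "lmult (f + g) t - lmult f t - lmult g t \<in> N"
proof (induction t rule: frag_induct)
  case (of p)
  then show ?case
    using assms by (cases p) (simp add: lmult_submodule_def distrib_right)
next
  case (diff t u)
  then show ?case
    using lmult_submoduleD(2) [OF assms diff] by (simp add: lmult_diff algebra_simps)
qed (simp add: lmult_submoduleD [OF assms])

quotient_type (overloaded) 'a tens_quot = "'a::comm_ring_1 tens set \<Rightarrow> 'a tens" /
  "\<lambda>\<phi> \<psi>. \<forall>N. lmult_submodule N \<longrightarrow> \<phi> N - \<psi> N \<in> N"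
proof (rule equivpI)
  show "reflp (\<lambda>\<phi> \<psi>. \<forall>N. lmult_submodule N \<longrightarrow> \<phi> N - \<psi> N \<in> N)"
    by (auto simp: lmult_submoduleD(1) intro!: reflpI)
  show "symp (\<lambda>\<phi> \<psi>. \<forall>N. lmult_submodule N \<longrightarrow> \<phi> N - \<psi> N \<in> N)"
    by (auto intro!: sympI) (metis lmult_submoduleD(4) minus_diff_eq)
  show "transp (\<lambda>\<phi> \<psi>. \<forall>N. lmult_submodule N \<longrightarrow> \<phi> N - \<psi> N \<in> N)"
    using lmult_submoduleD(5) by (fastforce intro!: transpI)
qed

instantiation tens_quot :: (comm_ring_1) ab_group_add
begin

lift_definition zero_tens_quot :: "'a tens_quot" is "\<lambda>N. 0" .

lift_definition plus_tens_quot :: "'a tens_quot \<Rightarrow> 'a tens_quot \<Rightarrow> 'a tens_quot" is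
  "\<lambda>\<phi> \<psi> N. \<phi> N + \<psi> N"
  using lmult_submoduleD(5) by (fastforce simp: add_diff_add)

lift_definition minus_tens_quot :: "'a tens_quot \<Rightarrow> 'a tens_quot \<Rightarrow> 'a tens_quot" is
  "\<lambda>\<phi> \<psi> N. \<phi> N - \<psi> N"
  using lmult_submoduleD(2) by (fastforce simp: algebra_simps)

lift_definition uminus_tens_quot :: "'a tens_quot \<Rightarrow> 'a tens_quot" is "\<lambda>\<phi> N. - \<phi> N"
  using lmult_submoduleD(4) by fastforce

instance
  by standard (transfer; simp add: lmult_submoduleD(1) algebra_simps)+

end

lift_definition tq_scale :: "'a::comm_ring_1 \<Rightarrow> 'a tens_quot \<Rightarrow> 'a tens_quot" is
  "\<lambda>f \<phi> N. lmult f (\<phi> N)"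
  by (auto simp: lmult_submoduleD(3) simp flip: lmult_diff)

interpretation tq: module tq_scale
proof
  fix f g :: "'a::comm_ring_1" and x y :: "'a tens_quot"
  show "tq_scale f (x + y) = tq_scale f x + tq_scale f y"
    by transfer (simp add: lmult_add lmult_submoduleD(1))
  show "tq_scale (f + g) x = tq_scale f x + tq_scale g x"
    by transfer (simp add: lmult_submodule_add_left flip: diff_diff_eq)
  show "tq_scale f (tq_scale g x) = tq_scale (f * g) x"
    by transfer (simp add: lmult_lmult lmult_submoduleD(1))
  show "tq_scale 1 x = x"
    by transfer (simp add: lmult_one lmult_submoduleD(1))
qed

text \<open>The passage from \<open>F\<close> to the factor \<open>F / N\<close>, followed by the
  inclusion of that factor into the product.\<close>

definition tq_of :: "'a::comm_ring_1 tens set \<Rightarrow> 'a tens \<Rightarrow> 'a tens_quot" where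
  "tq_of N t = abs_tens_quot (\<lambda>M. if M = N then t else 0)"

lemma tq_of_eq_iff: "lmult_submodule N \<Longrightarrow> tq_of N t = tq_of N u \<longleftrightarrow> t - u \<in> N"
  by (auto simp: tq_of_def tens_quot.abs_eq_iff lmult_submoduleD(1))

lemma tq_of_zero [simp]: "tq_of N 0 = 0"
  by (simp add: tq_of_def zero_tens_quot_def)

lemma tq_of_diff: "tq_of N (t - u) = tq_of N t - tq_of N u"
  by (simp add: tq_of_def minus_tens_quot.abs_eq tens_quot.abs_eq_iff lmult_submoduleD(1))

lemma tq_of_add: "tq_of N (t + u) = tq_of N t + tq_of N u"
  by (simp add: tq_of_def plus_tens_quot.abs_eq tens_quot.abs_eq_iff lmult_submoduleD(1))

lemma tq_of_lmult: "tq_of N (lmult f t) = tq_scale f (tq_of N t)"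
  by (simp add: tq_of_def tq_scale.abs_eq tens_quot.abs_eq_iff lmult_submoduleD(1))

lemma tensor_rels_ker_mult_sq: "t \<in> tensor_rels s \<Longrightarrow> t \<in> ker_mult_sq s"
  by (simp add: ker_mult_sq_def subgroup_span.base)

text \<open>Thus the subgroup \<open>J\<close> in the definition of \<Omega> is an admissible index,
  and \<Omega> sits inside the factor \<open>F / J\<close> of the product.\<close>

lemma (in comm_algebra) lmult_submodule_ker_mult_sq: "lmult_submodule (ker_mult_sq scale)"
proof -
  have "frag_of (a + a', b) - frag_of (a, b) - frag_of (a', b) \<in> ker_mult_sq scale" for a a' b
    by (rule tensor_rels_ker_mult_sq) (unfold tensor_rels_def, blast)
  then show ?thesis
    by (simp add: lmult_submodule_def ker_mult_sq_zero ker_mult_sq_diff ker_mult_sq_lmult)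
qed


section \<open>The universal property of the differentials\<close>

locale free_module_extension = module act
  for act :: "'a::comm_ring_1 \<Rightarrow> 'm::ab_group_add \<Rightarrow> 'm"
begin

definition lin_extend :: "('c \<Rightarrow> 'm) \<Rightarrow> ('c \<Rightarrow>\<^sub>0 int) \<Rightarrow> 'm" where
  "lin_extend h t = (\<Sum>p\<in>Poly_Mapping.keys t. act (of_int (Poly_Mapping.lookup t p)) (h p))"

lemma lin_extend_zero [simp]: "lin_extend h 0 = 0"
  by (simp add: lin_extend_def)

lemma lin_extend_of [simp]: "lin_extend h (frag_of p) = h p"
  by (simp add: lin_extend_def)

lemma lin_extend_diff: "lin_extend h (t - u) = lin_extend h t - lin_extend h u"
proof -
  let ?A = "Poly_Mapping.keys t \<union> Poly_Mapping.keys u"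
  have *: "lin_extend h v = (\<Sum>p\<in>?A. act (of_int (Poly_Mapping.lookup v p)) (h p))"
    if "Poly_Mapping.keys v \<subseteq> ?A" for v
    unfolding lin_extend_def using that
    by (intro sum.mono_neutral_left) (auto simp: in_keys_iff)
  show ?thesis
    by (simp add: * keys_diff lookup_minus scale_left_diff_distrib sum_subtractf)
qed

lemma lin_extend_add: "lin_extend h (t + u) = lin_extend h t + lin_extend h u"
  using lin_extend_diff [of h "t + u" u] by simp

lemma lin_extend_lmult:
  "lin_extend (\<lambda>(a, b). act a (h b)) (lmult f t) = act f (lin_extend (\<lambda>(a, b). act a (h b)) t)"
  by (induction t rule: frag_induct) (auto simp: lmult_diff lin_extend_diff scale_right_diff_distrib)

end

text \<open>The target module is left open because the derivations to come take values in the module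
  type around \<Omega>, in a twisted double of it, and in \<open>P_1\<close>.\<close>

locale module_derivation = R: comm_algebra s + M: free_module_extension act
  for s :: "'r::comm_ring_1 \<Rightarrow> 'a::comm_ring_1 \<Rightarrow> 'a" and act :: "'a \<Rightarrow> 'm::ab_group_add \<Rightarrow> 'm" +
  fixes \<delta> :: "'a \<Rightarrow> 'm"
  assumes \<delta>_add: "\<delta> (f + g) = \<delta> f + \<delta> g"
    and \<delta>_mult: "\<delta> (f * g) = act f (\<delta> g) + act g (\<delta> f)"
    and \<delta>_scale: "\<delta> (s r f) = act (s r 1) (\<delta> f)"
begin

sublocale \<delta>: additive \<delta>
  by standard (rule \<delta>_add)

abbreviation tens_lift :: "'a tens \<Rightarrow> 'm" where
  "tens_lift \<equiv> M.lin_extend (\<lambda>(a, b). act a (\<delta> b))"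

lemma \<delta>_one: "\<delta> 1 = 0"
  by (metis \<delta>_mult M.scale_one add_cancel_right_right mult_1)

text \<open>A product rule over the multiplication map: if \<open>t\<close> and \<open>u\<close> lie
  in the kernel of that map, both terms vanish. Therefore the lift annihilates the square of the
  kernel and descends to \<Omega>.\<close>

lemma tens_lift_tens_mult:
  "tens_lift (tens_mult t u) =
    act (ring_extend (\<lambda>(a, b). a * b) t) (tens_lift u) +
    act (ring_extend (\<lambda>(a, b). a * b) u) (tens_lift t)"
proof (induction t rule: frag_induct)
  case (of p)
  show ?case
  proof (induction u rule: frag_induct)
    case (of q)
    obtain a b c d where [simp]: "p = (a, b)" "q = (c, d)" by fastforce
    show ?case
      by (simp add: \<delta>_mult M.scale_right_distrib mult_ac)
  qed (simp_all add: tens_mult_diff M.lin_extend_diff ring_extend_diff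
        M.scale_right_diff_distrib M.scale_left_diff_distrib)
qed (simp_all add: tens_mult_diff M.lin_extend_diff ring_extend_diff
      M.scale_right_diff_distrib M.scale_left_diff_distrib)

lemma tens_lift_ker_mult_sq:
  assumes "t \<in> ker_mult_sq s"
  shows "tens_lift t = 0"
  using assms unfolding ker_mult_sq_def
proof (induction rule: subgroup_span.induct)
  case (base t)
  have "s r a = a * s r 1" for r a
    by (metis R.scale_mult_left mult.commute mult_1)
  then have scale: "act (s r a) x = act (a * s r 1) x" for r a x
    by metis
  have "tens_lift (frag_of (s r a, b) - frag_of (a, s r b)) = 0" for r a b
    by (simp add: M.lin_extend_diff \<delta>_scale scale [of r a])
  from base this show ?case
    by (auto simp: tensor_rels_def M.lin_extend_diff \<delta>_add M.scale_right_distrib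
        M.scale_left_distrib tens_lift_tens_mult ker_mult_def)
qed (simp_all add: M.lin_extend_diff)

definition form_lift :: "'a form \<Rightarrow> 'm" where
  "form_lift \<alpha> = tens_lift (rep \<alpha>)"

lemma form_lift_cls: "form_lift (cls s t) = tens_lift t"
  using tens_lift_ker_mult_sq [OF rep_cls [of s t]] by (simp add: form_lift_def M.lin_extend_diff)

lemma form_lift_kd: "form_lift (kd s f) = \<delta> f"
  by (simp add: kd_def form_lift_cls dtens_def M.lin_extend_diff \<delta>_one)

text \<open>Valid for arbitrary sets \<open>\<alpha>\<close> and \<open>\<beta>\<close>, because
  both sides see only the chosen representatives.\<close>

lemma form_lift_madd: "form_lift (madd (Omega s) \<alpha> \<beta>) = form_lift \<alpha> + form_lift \<beta>"
  by (simp add: Omega_def form_lift_cls M.lin_extend_add) (simp add: form_lift_def)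

lemma form_lift_mscale: "form_lift (mscale (Omega s) f \<alpha>) = act f (form_lift \<alpha>)"
  by (simp add: Omega_def form_lift_cls M.lin_extend_lmult) (simp add: form_lift_def)

end


section \<open>The module of differentials\<close>

context comm_algebra
begin

definition tens_vec :: "'a tens \<Rightarrow> 'a tens_quot" where
  "tens_vec = tq_of (ker_mult_sq scale)"

text \<open>The embedding of \<Omega> into the module type. An equation of forms is proved by
  applying it, which replaces the operations on classes by those of an abelian group.\<close>

definition vec :: "'a form \<Rightarrow> 'a tens_quot" where
  "vec \<alpha> = tens_vec (rep \<alpha>)"

lemma tens_vec_eq_iff: "tens_vec t = tens_vec u \<longleftrightarrow> t - u \<in> ker_mult_sq scale"
  by (simp add: tens_vec_def tq_of_eq_iff lmult_submodule_ker_mult_sq)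

lemma tens_vec_simps [simp]:
  "tens_vec 0 = 0"
  "tens_vec (t - u) = tens_vec t - tens_vec u"
  "tens_vec (t + u) = tens_vec t + tens_vec u"
  "tens_vec (lmult f t) = tq_scale f (tens_vec t)"
  by (simp_all add: tens_vec_def tq_of_diff tq_of_add tq_of_lmult)

lemma vec_cls: "vec (cls scale t) = tens_vec t"
  unfolding vec_def tens_vec_eq_iff by (rule rep_cls)

lemma vec_inj: "\<alpha> \<in> carrier (Omega scale) \<Longrightarrow> \<beta> \<in> carrier (Omega scale) \<Longrightarrow> vec \<alpha> = vec \<beta> \<longleftrightarrow> \<alpha> = \<beta>"
  by (auto simp: Omega_def vec_cls tens_vec_eq_iff simp flip: cls_eq_iff)

lemma vec_Omega [simp]:
  "vec (madd (Omega scale) \<alpha> \<beta>) = vec \<alpha> + vec \<beta>"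
  "vec (mscale (Omega scale) f \<alpha>) = tq_scale f (vec \<alpha>)"
  "vec (mzero (Omega scale)) = 0"
  by (simp_all add: Omega_def vec_cls) (simp_all add: vec_def)

lemma Omega_closed [simp, intro]:
  "\<alpha> \<in> carrier (Omega scale) \<Longrightarrow> \<beta> \<in> carrier (Omega scale) \<Longrightarrow>
    madd (Omega scale) \<alpha> \<beta> \<in> carrier (Omega scale)"
  "\<alpha> \<in> carrier (Omega scale) \<Longrightarrow> mscale (Omega scale) f \<alpha> \<in> carrier (Omega scale)"
  "mzero (Omega scale) \<in> carrier (Omega scale)"
  "kd scale f \<in> carrier (Omega scale)"
proof -
  \<comment> \<open>The chosen representatives of \<alpha> and \<beta> are not known to lie in the
    kernel. It is enough that the resulting class agrees with that of a kernel element.\<close>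
  have *: "cls scale u \<in> cls scale ` ker_mult" if "t \<in> ker_mult" "tens_vec u = tens_vec t" for t u
    using that by (metis cls_eq_iff imageI tens_vec_eq_iff)
  show "madd (Omega scale) \<alpha> \<beta> \<in> carrier (Omega scale)"
    if "\<alpha> \<in> carrier (Omega scale)" "\<beta> \<in> carrier (Omega scale)"
  proof -
    obtain t u where "t \<in> ker_mult" "u \<in> ker_mult" "\<alpha> = cls scale t" "\<beta> = cls scale u"
      using \<open>\<alpha> \<in> _\<close> \<open>\<beta> \<in> _\<close> by (auto simp: Omega_def)
    then show ?thesis
      using * [OF ker_mult_add, of t u] by (simp add: Omega_def vec_cls [unfolded vec_def])
  qed
  show "mscale (Omega scale) f \<alpha> \<in> carrier (Omega scale)" if "\<alpha> \<in> carrier (Omega scale)"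
  proof -
    obtain t where "t \<in> ker_mult" "\<alpha> = cls scale t"
      using \<open>\<alpha> \<in> _\<close> by (auto simp: Omega_def)
    then show ?thesis
      using * [OF ker_mult_lmult, of t] by (simp add: Omega_def vec_cls [unfolded vec_def])
  qed
qed (auto simp: Omega_def kd_def)

section \<open>Exact forms as generators\<close>

lemma tens_vec_of: "tens_vec (frag_of (f, g)) = tq_scale f (tens_vec (frag_of (1, g)))"
  using tens_vec_simps(4) [of f "frag_of (1, g)"] by simp

lemma vec_kd: "vec (kd scale f) = tens_vec (dtens f)"
  by (simp add: kd_def vec_cls)

lemma vec_kd_eq: "vec (kd scale f) = tens_vec (frag_of (1, f)) - tens_vec (frag_of (f, 1))"
  by (simp add: kd_def vec_cls dtens_def)

text \<open>The Leibniz rule is the reason for dividing by the square of the kernel: \<open>df * dg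
  = 1 \<otimes> fg - f \<otimes> g - g \<otimes> f + fg \<otimes> 1\<close> lies in it, so
  \<open>1 \<otimes> fg - fg \<otimes> 1\<close> equals \<open>f dg + g df\<close> modulo
  it.\<close>

lemma module_derivation_kd: "module_derivation scale tq_scale (\<lambda>f. vec (kd scale f))"
proof
  fix f g r
  have "frag_of (1, f + g) - frag_of (1, f) - frag_of (1, g) \<in> tensor_rels scale"
    unfolding tensor_rels_def by blast
  then have "tens_vec (frag_of (1, f + g)) = tens_vec (frag_of (1, f)) + tens_vec (frag_of (1, g))"
    by (simp add: tens_vec_eq_iff tensor_rels_ker_mult_sq diff_diff_eq flip: tens_vec_simps)
  then show "vec (kd scale (f + g)) = vec (kd scale f) + vec (kd scale g)"
    by (simp add: vec_kd_eq tens_vec_of [of "f + g"] tens_vec_of [of f] tens_vec_of [of g]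
        tq.scale_left_distrib)
  have "tens_mult (dtens f) (dtens g) \<in> ker_mult_sq scale"
    unfolding ker_mult_sq_def by (rule subgroup_span.base) (use ker_mult_dtens in blast)
  then have "tens_vec (tens_mult (dtens f) (dtens g)) = 0"
    using tens_vec_eq_iff [of _ 0] by simp
  then show "vec (kd scale (f * g)) = tq_scale f (vec (kd scale g)) + tq_scale g (vec (kd scale f))"
    by (simp add: vec_kd_eq dtens_def tens_mult_diff tens_vec_of [of f] tens_vec_of [of g]
       tens_vec_of [of "f * g"] tq.scale_right_diff_distrib mult.commute algebra_simps)
  have "frag_of (scale r 1, f) - frag_of (1, scale r f) \<in> tensor_rels scale"
    unfolding tensor_rels_def by blast
  then have "tens_vec (frag_of (1, scale r f)) = tens_vec (frag_of (scale r 1, f))"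
    by (metis tens_vec_eq_iff tensor_rels_ker_mult_sq)
  moreover have "scale r f = scale r 1 * f"
    using scale_mult_left [of r 1 f] by simp
  ultimately show "vec (kd scale (scale r f)) = tq_scale (scale r 1) (vec (kd scale f))"
    by (simp add: vec_kd_eq tens_vec_of [of "scale r 1"] tens_vec_of [of f] tens_vec_of [of "scale r 1 * f"]
        tq.scale_right_diff_distrib)
qed

text \<open>For \<open>t = \<Sum> a \<otimes> b\<close> one has
  \<open>\<Sum> a db = t - (\<Sum> a b) \<otimes> 1\<close>, which is \<open>t\<close> if
  \<open>t\<close> lies in the kernel. Zero and differences are covered by the multiples with
  \<open>0\<close> and \<open>- 1\<close>.\<close>

lemma Omega_induct [consumes 1, case_names kd madd mscale]:
  assumes "\<alpha> \<in> carrier (Omega scale)"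
    and kd: "\<And>f. P (kd scale f)"
    and madd: "\<And>\<alpha> \<beta>. \<alpha> \<in> carrier (Omega scale) \<Longrightarrow> \<beta> \<in> carrier (Omega scale) \<Longrightarrow>
      P \<alpha> \<Longrightarrow> P \<beta> \<Longrightarrow> P (madd (Omega scale) \<alpha> \<beta>)"
    and mscale: "\<And>f \<alpha>. \<alpha> \<in> carrier (Omega scale) \<Longrightarrow> P \<alpha> \<Longrightarrow> P (mscale (Omega scale) f \<alpha>)"
  shows "P \<alpha>"
proof -
  let ?T = "frag_extend (\<lambda>(a, b). lmult a (dtens b))"
  have T_ker: "?T t \<in> ker_mult" for t
    by (induction t rule: frag_induct) (auto simp: frag_extend_diff ker_mult_diff ker_mult_lmult)
  then have T_Omega: "cls scale (?T t) \<in> carrier (Omega scale)" for t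
    by (auto simp: Omega_def)
  have P_T: "P (cls scale (?T t))" for t
  proof (induction t rule: frag_induct)
    case zero
    have "cls scale (?T 0) = mscale (Omega scale) 0 (kd scale 0)"
      using T_Omega [of 0] by (subst vec_inj [symmetric]) (auto simp: vec_cls)
    then show ?case using kd mscale by auto
  next
    case (of p)
    obtain a b where "p = (a, b)" by fastforce
    then have "cls scale (?T (frag_of p)) = mscale (Omega scale) a (kd scale b)"
      using T_Omega [of "frag_of p"] by (subst vec_inj [symmetric]) (auto simp: vec_cls vec_kd)
    then show ?case using kd mscale by auto
  next
    case (diff t u)
    have "cls scale (?T (t - u)) =
        madd (Omega scale) (cls scale (?T t)) (mscale (Omega scale) (- 1) (cls scale (?T u)))"
      using T_Omega [of t] T_Omega [of u] T_Omega [of "t - u"]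
      by (subst vec_inj [symmetric]) (auto simp: vec_cls frag_extend_diff)
    then show ?case using diff madd mscale T_Omega by auto
  qed
  obtain t where t: "t \<in> ker_mult" "\<alpha> = cls scale t"
    using assms(1) by (auto simp: Omega_def)
  have "tens_vec (?T t) = tens_vec t -
      tq_scale (ring_extend (\<lambda>(a, b). a * b) t) (tens_vec (frag_of (1, 1)))" for t
  proof (induction t rule: frag_induct)
    case (of p)
    obtain a b where "p = (a, b)" by fastforce
    then show ?case
      by (simp add: dtens_def tens_vec_of [of a] tens_vec_of [of b] tq.scale_right_diff_distrib)
  qed (simp_all add: frag_extend_diff ring_extend_diff tq.scale_left_diff_distrib)
  with t have "cls scale (?T t) = \<alpha>"
    by (simp add: cls_eq_iff ker_mult_def flip: tens_vec_eq_iff)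
  with P_T show ?thesis by metis
qed

text \<open>Symmetry confines all work to the second argument: it is made general for an exact first
  argument, the arguments are swapped, and it is made general once more.\<close>

lemma Omega_induct2 [consumes 2, case_names sym kd madd mscale]:
  assumes "\<alpha> \<in> carrier (Omega scale)" "\<beta> \<in> carrier (Omega scale)"
    and sym: "\<And>\<alpha> \<beta>. \<alpha> \<in> carrier (Omega scale) \<Longrightarrow> \<beta> \<in> carrier (Omega scale) \<Longrightarrow>
      P \<alpha> \<beta> \<Longrightarrow> P \<beta> \<alpha>"
    and kd: "\<And>f g. P (kd scale f) (kd scale g)"
    and madd: "\<And>\<alpha> \<beta> \<gamma>. \<alpha> \<in> carrier (Omega scale) \<Longrightarrow> \<beta> \<in> carrier (Omega scale) \<Longrightarrow>
      \<gamma> \<in> carrier (Omega scale) \<Longrightarrow> P \<alpha> \<beta> \<Longrightarrow> P \<alpha> \<gamma> \<Longrightarrow> P \<alpha> (madd (Omega scale) \<beta> \<gamma>)"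
    and mscale: "\<And>f \<alpha> \<beta>. \<alpha> \<in> carrier (Omega scale) \<Longrightarrow> \<beta> \<in> carrier (Omega scale) \<Longrightarrow>
      P \<alpha> \<beta> \<Longrightarrow> P \<alpha> (mscale (Omega scale) f \<beta>)"
  shows "P \<alpha> \<beta>"
proof -
  have "P (kd scale f) \<beta>" if "\<beta> \<in> carrier (Omega scale)" for f \<beta>
    using that by (induction rule: Omega_induct) (auto intro: kd madd mscale)
  then have "P \<alpha> (kd scale f)" for f
    using assms(1) sym by blast
  with assms(2) show ?thesis
    by (induction rule: Omega_induct) (auto intro: madd mscale assms(1))
qed

text \<open>A rotation takes the place of the swap: it carries the exact form in front to the end,
  where it is generalised next.\<close>

lemma Omega_induct3 [consumes 3, case_names cyclic kd madd mscale]: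
  assumes "\<alpha> \<in> carrier (Omega scale)" "\<beta> \<in> carrier (Omega scale)" "\<gamma> \<in> carrier (Omega scale)"
    and cyclic: "\<And>\<alpha> \<beta> \<gamma>. \<alpha> \<in> carrier (Omega scale) \<Longrightarrow> \<beta> \<in> carrier (Omega scale) \<Longrightarrow>
      \<gamma> \<in> carrier (Omega scale) \<Longrightarrow> P \<alpha> \<beta> \<gamma> \<Longrightarrow> P \<beta> \<gamma> \<alpha>"
    and kd: "\<And>f g h. P (kd scale f) (kd scale g) (kd scale h)"
    and madd: "\<And>\<alpha> \<beta> \<gamma> \<gamma>'. \<alpha> \<in> carrier (Omega scale) \<Longrightarrow> \<beta> \<in> carrier (Omega scale) \<Longrightarrow>
      \<gamma> \<in> carrier (Omega scale) \<Longrightarrow> \<gamma>' \<in> carrier (Omega scale) \<Longrightarrow>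
      P \<alpha> \<beta> \<gamma> \<Longrightarrow> P \<alpha> \<beta> \<gamma>' \<Longrightarrow> P \<alpha> \<beta> (madd (Omega scale) \<gamma> \<gamma>')"
    and mscale: "\<And>f \<alpha> \<beta> \<gamma>. \<alpha> \<in> carrier (Omega scale) \<Longrightarrow> \<beta> \<in> carrier (Omega scale) \<Longrightarrow>
      \<gamma> \<in> carrier (Omega scale) \<Longrightarrow> P \<alpha> \<beta> \<gamma> \<Longrightarrow> P \<alpha> \<beta> (mscale (Omega scale) f \<gamma>)"
  shows "P \<alpha> \<beta> \<gamma>"
proof -
  have 1: "P (kd scale f) (kd scale g) \<gamma>" if "\<gamma> \<in> carrier (Omega scale)" for f g \<gamma>
    using that by (induction rule: Omega_induct) (auto intro: kd madd mscale)
  have 2: "P (kd scale f) \<beta> \<gamma>" if "\<beta> \<in> carrier (Omega scale)" "\<gamma> \<in> carrier (Omega scale)" for f \<beta> \<gamma>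
    using that(2)
  proof (induction rule: Omega_induct)
    case (kd g)
    show ?case using 1 [OF that(1)] that(1) cyclic by (meson Omega_closed(4))
  qed (auto intro: madd mscale that)
  from assms(3) show ?thesis
  proof (induction rule: Omega_induct)
    case (kd g)
    show ?case using 2 [OF assms(1,2)] assms(1,2) cyclic by (meson Omega_closed(4))
  qed (auto intro: madd mscale assms)
qed

end


section \<open>The Lie algebroid of a Poisson algebra\<close>

lemma ring_extend_plus: "ring_extend h (t + u) = ring_extend h t + ring_extend h u"
  using ring_extend_diff [of h "t + u" u] by simp

lemma form_eval_plus: "form_eval \<alpha> (\<lambda>f. X f + Y f) = form_eval \<alpha> X + form_eval \<alpha> Y"
  by (simp add: form_eval_def split_def distrib_left ring_extend_add)

lemma form_eval_times: "form_eval \<alpha> (\<lambda>f. a * X f) = a * form_eval \<alpha> X"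
  by (simp add: form_eval_def split_def mult.left_commute [of _ a] ring_extend_mult)

context comm_algebra
begin

interpretation kd: module_derivation scale tq_scale "\<lambda>f. vec (kd scale f)"
  by (rule module_derivation_kd)

lemma scale_eq: "scale r f = scale r 1 * f"
  using scale_mult_left [of r 1 f] by simp

lemma kd_eq:
  "kd scale (f + g) = madd (Omega scale) (kd scale f) (kd scale g)"
  "kd scale (f * g) =
    madd (Omega scale) (mscale (Omega scale) f (kd scale g)) (mscale (Omega scale) g (kd scale f))"
  "kd scale (scale r f) = mscale (Omega scale) (scale r 1) (kd scale f)"
  by (subst vec_inj [symmetric]; simp add: kd.\<delta>_add kd.\<delta>_mult kd.\<delta>_scale [of r])+

lemma Der_iff:
  "X \<in> carrier (Der scale) \<longleftrightarrow>
    (\<forall>f g. X (f + g) = X f + X g) \<and> (\<forall>r f. X (scale r f) = scale r (X f)) \<and>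
    (\<forall>f g. X (f * g) = X f * g + f * X g)"
  by (auto simp: Der_def linear_map_def whole_def)

lemma form_eval_Omega:
  assumes "X \<in> carrier (Der scale)"
  shows "form_eval (madd (Omega scale) \<alpha> \<beta>) X = form_eval \<alpha> X + form_eval \<beta> X"
    "form_eval (mscale (Omega scale) f \<alpha>) X = f * form_eval \<alpha> X"
    "form_eval (mzero (Omega scale)) X = 0"
    "form_eval (kd scale f) X = X f"
  using assms comm_algebra_axioms
  by (simp_all add: Omega_def form_eval_cls form_eval_kd ring_extend_plus ring_extend_lmult)
    (simp_all add: form_eval_def)

definition vcontr :: "('a \<Rightarrow> 'a) \<Rightarrow> 'a form \<Rightarrow> 'a tens_quot" where
  "vcontr X \<alpha> = vec (contr_d scale \<alpha> X)"

lemma contr_d_closed: "contr_d scale \<alpha> X \<in> carrier (Omega scale)"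
proof -
  have "frag_extend (\<lambda>(a, b). lmult (X a) (dtens b) - lmult (X b) (dtens a)) t \<in> ker_mult" for t
    by (induction t rule: frag_induct) (auto simp: frag_extend_diff ker_mult_diff ker_mult_lmult)
  then show ?thesis
    by (auto simp: contr_d_def Omega_def)
qed

text \<open>In the bracket of forms \<open>X\<close> is the anchor of a form, so this becomes
  linearity in that form.\<close>

lemma vcontr_fun:
  "vcontr (\<lambda>f. X f + Y f) \<alpha> = vcontr X \<alpha> + vcontr Y \<alpha>"
  "vcontr (\<lambda>f. a * X f) \<alpha> = tq_scale a (vcontr X \<alpha>)"
proof -
  have "tens_vec (frag_extend (\<lambda>(a, b). lmult (X a + Y a) (dtens b) - lmult (X b + Y b) (dtens a)) t) =
      tens_vec (frag_extend (\<lambda>(a, b). lmult (X a) (dtens b) - lmult (X b) (dtens a)) t) +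
      tens_vec (frag_extend (\<lambda>(a, b). lmult (Y a) (dtens b) - lmult (Y b) (dtens a)) t)" for t
    by (induction t rule: frag_induct) (auto simp: frag_extend_diff tq.scale_left_distrib)
  then show "vcontr (\<lambda>f. X f + Y f) \<alpha> = vcontr X \<alpha> + vcontr Y \<alpha>"
    by (simp add: vcontr_def contr_d_def vec_cls)
  have "tens_vec (frag_extend (\<lambda>(c, b). lmult (a * X c) (dtens b) - lmult (a * X b) (dtens c)) t) =
      tq_scale a (tens_vec (frag_extend (\<lambda>(a, b). lmult (X a) (dtens b) - lmult (X b) (dtens a)) t))" for t
    by (induction t rule: frag_induct) (auto simp: frag_extend_diff tq.scale_right_diff_distrib)
  then show "vcontr (\<lambda>f. a * X f) \<alpha> = tq_scale a (vcontr X \<alpha>)"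
    by (simp add: vcontr_def contr_d_def vec_cls)
qed

text \<open>
  The Lie derivative \<open>a db \<mapsto> X(a) db + a d(X b)\<close> is not \<open>P\<^sub>0\<close>-linear, but \<open>\<omega> \<mapsto> (\<omega>, L\<^sub>X \<omega>)\<close> is, for the
  action of \<open>P\<^sub>0\<close> through \<open>f \<mapsto> f + \<epsilon> X(f)\<close>. By the universal property, \<open>L\<^sub>X\<close> and hence
  \<open>(d\<omega>)(X, \<cdot>) = L\<^sub>X \<omega> - d(\<omega>(X))\<close> are well defined.
\<close>

lemma vcontr_Omega:
  assumes X: "X \<in> carrier (Der scale)"
  shows "vcontr X (madd (Omega scale) \<alpha> \<beta>) = vcontr X \<alpha> + vcontr X \<beta>"
    and "\<alpha> \<in> carrier (Omega scale) \<Longrightarrow> vcontr X (mscale (Omega scale) f \<alpha>) =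
      tq_scale f (vcontr X \<alpha>) + tq_scale (X f) (vec \<alpha>) - tq_scale (form_eval \<alpha> X) (vec (kd scale f))"
    and "vcontr X (kd scale f) = 0"
proof -
  note X' = derivation_additive [OF X] derivation_mult [OF X] derivation_scale [OF X] derivation_one [OF X]
  \<comment> \<open>The pair stands for \<open>\<omega> + \<epsilon> \<omega>'\<close> with
    \<open>\<epsilon>^2 = 0\<close>, and the derivation is
    \<open>f \<mapsto> df + \<epsilon> d(X f)\<close>. The twisted action satisfies the module laws
    because \<open>X\<close> is a derivation.\<close>
  interpret L: module_derivation scale "\<lambda>f \<omega>. (tq_scale f (fst \<omega>), tq_scale f (snd \<omega>) + tq_scale (X f) (fst \<omega>))"
    "\<lambda>f. (vec (kd scale f), vec (kd scale (X f)))"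
  proof
    have "X (scale r 1) = 0" for r
      by (simp add: X')
    then show "(vec (kd scale (scale r f)), vec (kd scale (X (scale r f)))) =
      (tq_scale (scale r 1) (fst (vec (kd scale f), vec (kd scale (X f)))),
       tq_scale (scale r 1) (snd (vec (kd scale f), vec (kd scale (X f)))) +
       tq_scale (X (scale r 1)) (fst (vec (kd scale f), vec (kd scale (X f)))))" for r f
      by (simp add: X' kd.\<delta>_scale [of r])
  qed (simp_all add: X' kd.\<delta>_add kd.\<delta>_mult algebra_simps)
  \<comment> \<open>Cartan's formula on a pure tensor:
    \<open>X(a) db + a d(X b) - d(a X(b)) = X(a) db - X(b) da\<close>.\<close>
  have "tens_vec (frag_extend (\<lambda>(a, b). lmult (X a) (dtens b) - lmult (X b) (dtens a)) t) =
      snd (L.tens_lift t) - vec (kd scale (ring_extend (\<lambda>(a, b). a * X b) t))" for t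
  proof (induction t rule: frag_induct)
    case (of p)
    show ?case
      by (cases p) (simp add: kd.\<delta>_mult flip: vec_kd)
  qed (simp_all add: frag_extend_diff L.M.lin_extend_diff ring_extend_diff kd.\<delta>.diff kd.\<delta>.zero)
  then have vcontr: "vcontr X \<alpha> = snd (L.form_lift \<alpha>) - vec (kd scale (form_eval \<alpha> X))" for \<alpha>
    by (simp add: vcontr_def contr_d_def vec_cls L.form_lift_def form_eval_def)
  \<comment> \<open>The first component lifts \<open>d\<close>, hence is the identity on \<Omega>;
    it turns the \<epsilon>-part of the scalar action into \<open>X(f) \<alpha>\<close>.\<close>
  have fst: "fst (L.form_lift \<alpha>) = vec \<alpha>" if "\<alpha> \<in> carrier (Omega scale)" for \<alpha>
    using that by (induction rule: Omega_induct) (simp_all add: L.form_lift_kd L.form_lift_madd L.form_lift_mscale)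
  show "vcontr X (madd (Omega scale) \<alpha> \<beta>) = vcontr X \<alpha> + vcontr X \<beta>"
    using X by (simp add: vcontr L.form_lift_madd form_eval_Omega kd.\<delta>_add)
  show "vcontr X (mscale (Omega scale) f \<alpha>) = tq_scale f (vcontr X \<alpha>) + tq_scale (X f) (vec \<alpha>) -
      tq_scale (form_eval \<alpha> X) (vec (kd scale f))" if "\<alpha> \<in> carrier (Omega scale)"
    using X that
    by (simp add: vcontr L.form_lift_mscale fst form_eval_Omega kd.\<delta>_mult algebra_simps)
  show "vcontr X (kd scale f) = 0"
    using X by (simp add: vcontr L.form_lift_kd form_eval_Omega)
qed

end

locale poisson_algebra = comm_algebra s
  for s :: "'r::comm_ring_1 \<Rightarrow> 'a::comm_ring_1 \<Rightarrow> 'a" +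
  fixes alt :: bool and br :: "'a \<Rightarrow> 'a \<Rightarrow> 'a"
  assumes poisson: "poisson_structure alt (whole s) (*) br"
begin

abbreviation \<Omega> :: "'a form set" where "\<Omega> \<equiv> carrier (Omega s)"
abbreviation form_add (infixl "\<oplus>" 65) where "\<alpha> \<oplus> \<beta> \<equiv> madd (Omega s) \<alpha> \<beta>"
abbreviation form_scale (infixr "\<odot>" 70) where "f \<odot> \<alpha> \<equiv> mscale (Omega s) f \<alpha>"
abbreviation form_zero ("\<zero>") where "\<zero> \<equiv> mzero (Omega s)"
abbreviation d where "d \<equiv> kd s"
abbreviation \<rho> where "\<rho> \<equiv> anchor br"
abbreviation fbr where "fbr \<equiv> form_bracket s br"

interpretation kd: module_derivation s tq_scale "\<lambda>f. vec (d f)"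
  by (rule module_derivation_kd)

lemma br_add: "br (f + g) h = br f h + br g h" "br f (g + h) = br f g + br f h"
  and br_scale: "br (s r f) g = s r (br f g)" "br f (s r g) = s r (br f g)"
  and br_skew: "br f g = - br g f"
  and br_alt: "alt \<Longrightarrow> br f f = 0"
  and br_mult: "br f (g * h) = br f g * h + g * br f h"
  and br_jacobi: "br f (br g h) + (br g (br h f) + br h (br f g)) = 0"
  using poisson
  by (simp_all add: poisson_structure_def lie_bracket_def bilinear_map_def linear_map_def
      skew_symmetric_def whole_def eq_neg_iff_add_eq_0)

lemma br_minus: "br f (- g) = - br f g"
  using br_add(2) [of f g "- g"] br_add(2) [of f 0 0] by (simp add: eq_neg_iff_add_eq_0 add.commute)

lemma br_mult_left: "br (f * g) h = br f h * g + f * br g h"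
  using br_mult [of h f g] br_skew [of "f * g" h] br_skew [of f h] br_skew [of g h] by simp

lemma br_Der: "br f \<in> carrier (Der s)" "(\<lambda>f. br f g) \<in> carrier (Der s)"
  by (simp_all add: Der_iff br_add br_scale br_mult br_mult_left)

lemma anchor_Der [simp]: "\<rho> \<alpha> \<in> carrier (Der s)"
proof -
  have "form_eval \<alpha> (\<lambda>h. s r (br h f)) = s r (form_eval \<alpha> (\<lambda>h. br h f))" for r f
    using form_eval_times [of \<alpha> "s r 1" "\<lambda>h. br h f"] by (simp flip: scale_mult_left)
  moreover have "form_eval \<alpha> (\<lambda>h. br h f * g) = form_eval \<alpha> (\<lambda>h. br h f) * g" for f g
    using form_eval_times [of \<alpha> g "\<lambda>h. br h f"] by (simp add: mult.commute)
  ultimately show ?thesis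
    by (simp add: Der_iff anchor_def br_add br_scale br_mult form_eval_plus form_eval_times)
qed

lemmas \<rho>_add = derivation_additive [OF anchor_Der]
  and \<rho>_mult = derivation_mult [OF anchor_Der]
  and \<rho>_scale = derivation_scale [OF anchor_Der]

lemma \<rho>_minus: "\<rho> \<alpha> (- f) = - \<rho> \<alpha> f"
  by (rule additive.minus [OF additive.intro]) (rule \<rho>_add)

lemma \<rho>_zero [simp]: "\<rho> \<alpha> 0 = 0"
  by (rule additive.zero [OF additive.intro]) (rule \<rho>_add)

lemma \<rho>_one: "\<rho> \<alpha> (s r 1) = 0"
  by (simp add: \<rho>_scale derivation_one [OF anchor_Der])

lemma \<rho>_Omega [simp]:
  "\<rho> (\<alpha> \<oplus> \<beta>) = (\<lambda>g. \<rho> \<alpha> g + \<rho> \<beta> g)" "\<rho> (f \<odot> \<alpha>) = (\<lambda>g. f * \<rho> \<alpha> g)" "\<rho> (\<zero>) = (\<lambda>g. 0)" "\<rho> (d f) = br f"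
  by (simp_all add: anchor_def form_eval_Omega br_Der)

text \<open>\<open>\<beta>(\<rho>(\<alpha>))\<close> is the Poisson bivector evaluated at \<alpha>
  and \<beta>; at \<open>d f\<close> and \<open>d g\<close> it is \<open>{f, g}\<close>.\<close>

lemma form_eval_skew:
  assumes "\<alpha> \<in> \<Omega>" "\<beta> \<in> \<Omega>"
  shows "form_eval \<alpha> (\<rho> \<beta>) = - form_eval \<beta> (\<rho> \<alpha>)"
  using assms
proof (induction rule: Omega_induct2)
  case (kd f g)
  show ?case by (simp add: form_eval_Omega br_Der br_skew [of g f])
qed (simp_all add: form_eval_Omega form_eval_plus form_eval_times)

text \<open>A quadratic condition, yet it passes from exact forms to all forms: the cross terms of a
  sum cancel by skewness, and a factor \<open>f\<close> comes out as \<open>f * f\<close>.\<close>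

lemma form_eval_alt:
  assumes "\<alpha> \<in> \<Omega>" "alt"
  shows "form_eval \<alpha> (\<rho> \<alpha>) = 0"
  using assms(1)
proof (induction rule: Omega_induct)
  case (madd \<alpha> \<beta>)
  then show ?case
    using form_eval_skew [of \<alpha> \<beta>] anchor_Der [of "\<alpha> \<oplus> \<beta>"]
    by (simp add: form_eval_Omega form_eval_plus)
next
  case (mscale f \<alpha>)
  then show ?case
    using anchor_Der [of "f \<odot> \<alpha>"] by (simp add: form_eval_Omega form_eval_times)
qed (use assms(2) in \<open>simp add: form_eval_Omega br_Der br_alt\<close>)

lemma fbr_closed [simp]: "fbr \<alpha> \<beta> \<in> \<Omega>"
  by (simp add: form_bracket_def contr_d_closed)

lemma vec_fbr:
  "vec (fbr \<alpha> \<beta>) = vcontr (\<rho> \<alpha>) \<beta> - vcontr (\<rho> \<beta>) \<alpha> + vec (d (form_eval \<beta> (\<rho> \<alpha>)))"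
  by (simp add: form_bracket_def vcontr_def)

lemma vec_fbr_skew:
  assumes "\<alpha> \<in> \<Omega>" "\<beta> \<in> \<Omega>"
  shows "vec (fbr \<alpha> \<beta>) = - vec (fbr \<beta> \<alpha>)"
  using form_eval_skew [OF assms] by (simp add: vec_fbr kd.\<delta>.minus)

lemma fbr_alt:
  assumes "\<alpha> \<in> \<Omega>" "alt"
  shows "fbr \<alpha> \<alpha> = \<zero>"
  using form_eval_alt [OF assms] by (subst vec_inj [symmetric]) (simp_all add: vec_fbr kd.\<delta>.zero)

lemma vec_fbr_add_right: "vec (fbr \<alpha> (\<beta> \<oplus> \<gamma>)) = vec (fbr \<alpha> \<beta>) + vec (fbr \<alpha> \<gamma>)"
  by (simp add: vec_fbr vcontr_Omega vcontr_fun form_eval_Omega kd.\<delta>_add)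

text \<open>The term \<open>\<beta>(\<rho>(\<alpha>)) df\<close> occurs twice with opposite signs,
  in the contraction of \<open>f \<beta>\<close> and in
  \<open>d(f \<beta>(\<rho>(\<alpha>)))\<close>; only the anchor term survives.\<close>

lemma vec_fbr_scale_right:
  assumes "\<alpha> \<in> \<Omega>" "\<beta> \<in> \<Omega>"
  shows "vec (fbr \<alpha> (f \<odot> \<beta>)) = tq_scale f (vec (fbr \<alpha> \<beta>)) + tq_scale (\<rho> \<alpha> f) (vec \<beta>)"
  using assms
  by (simp add: vec_fbr vcontr_Omega vcontr_fun form_eval_Omega kd.\<delta>_mult algebra_simps)

lemma fbr_add_right: "fbr \<alpha> (\<beta> \<oplus> \<gamma>) = fbr \<alpha> \<beta> \<oplus> fbr \<alpha> \<gamma>"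
  by (subst vec_inj [symmetric]) (simp_all add: vec_fbr_add_right)

lemma fbr_scale_right:
  assumes "\<alpha> \<in> \<Omega>" "\<beta> \<in> \<Omega>"
  shows "fbr \<alpha> (f \<odot> \<beta>) = (f \<odot> fbr \<alpha> \<beta>) \<oplus> (\<rho> \<alpha> f \<odot> \<beta>)"
  using assms by (subst vec_inj [symmetric]) (simp_all add: vec_fbr_scale_right)

lemma fbr_skew:
  assumes "\<alpha> \<in> \<Omega>" "\<beta> \<in> \<Omega>"
  shows "fbr \<alpha> \<beta> = (- 1) \<odot> fbr \<beta> \<alpha>"
  using assms by (subst vec_inj [symmetric]) (simp_all add: vec_fbr_skew [of \<alpha>])

lemma fbr_add_left:
  assumes "\<alpha> \<in> \<Omega>" "\<beta> \<in> \<Omega>" "\<gamma> \<in> \<Omega>"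
  shows "fbr (\<alpha> \<oplus> \<beta>) \<gamma> = fbr \<alpha> \<gamma> \<oplus> fbr \<beta> \<gamma>"
  using assms
  by (subst vec_inj [symmetric]) (simp_all add: vec_fbr_skew [of _ \<gamma>] vec_fbr_add_right)

lemma fbr_scale_left:
  assumes "\<alpha> \<in> \<Omega>" "\<beta> \<in> \<Omega>"
  shows "fbr (f \<odot> \<alpha>) \<beta> = (f \<odot> fbr \<alpha> \<beta>) \<oplus> ((- \<rho> \<beta> f) \<odot> \<alpha>)"
  using assms
  by (subst vec_inj [symmetric]) (simp_all add: vec_fbr_skew [of _ \<beta>] vec_fbr_scale_right)

text \<open>Exact forms are closed, so both contractions vanish.\<close>

lemma fbr_kd: "fbr (d f) (d g) = d (br f g)"
  by (subst vec_inj [symmetric]) (simp_all add: vec_fbr vcontr_Omega br_Der form_eval_Omega)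

text \<open>On exact forms this is the Jacobi identity of \<open>br\<close>, and both sides obey the
  same Leibniz rule in \<beta>. It cancels the second-order terms in the Jacobi identity of
  \<Omega>.\<close>

lemma \<rho>_fbr:
  assumes "\<alpha> \<in> \<Omega>" "\<beta> \<in> \<Omega>"
  shows "\<rho> (fbr \<alpha> \<beta>) g = \<rho> \<alpha> (\<rho> \<beta> g) - \<rho> \<beta> (\<rho> \<alpha> g)"
  using assms
proof (induction rule: Omega_induct2)
  case (sym \<alpha> \<beta>)
  then show ?case by (subst fbr_skew) simp_all
next
  case (kd f h)
  show ?case
    using br_jacobi [of f h g] br_minus [of h "br f g"]
    by (simp add: fbr_kd br_skew [of "br f h" g] br_skew [of g f] algebra_simps)
next
  case (madd \<alpha> \<beta> \<gamma>)
  then show ?case by (simp add: fbr_add_right \<rho>_add)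
next
  case (mscale f \<alpha> \<beta>)
  show ?case
    using mscale(1,2) by (simp add: fbr_scale_right \<rho>_mult mscale(3) algebra_simps)
qed

text \<open>Replacing \<gamma> by \<open>f \<gamma>\<close> multiplies the sum by \<open>f\<close>
  and adds terms in \<open>\<rho>(\<alpha>)(f)\<close> and \<open>\<rho>(\<beta>)(f)\<close>, which
  cancel in pairs, and \<open>(\<rho>(\<alpha>) \<rho>(\<beta>) - \<rho>(\<beta>) \<rho>(\<alpha>) -
  \<rho>[\<alpha>, \<beta>])(f) \<gamma>\<close>, which is zero by \<open>\<rho>_fbr\<close>. On
  exact forms the identity is \<open>d\<close> applied to the Jacobi identity of
  \<open>br\<close>.\<close>

lemma fbr_jacobi:
  assumes "\<alpha> \<in> \<Omega>" "\<beta> \<in> \<Omega>" "\<gamma> \<in> \<Omega>"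
  shows "fbr \<alpha> (fbr \<beta> \<gamma>) \<oplus> (fbr \<beta> (fbr \<gamma> \<alpha>) \<oplus> fbr \<gamma> (fbr \<alpha> \<beta>)) = \<zero>"
proof -
  have "vec (fbr \<alpha> (fbr \<beta> \<gamma>)) + (vec (fbr \<beta> (fbr \<gamma> \<alpha>)) + vec (fbr \<gamma> (fbr \<alpha> \<beta>))) = 0"
    using assms
  proof (induction rule: Omega_induct3)
    case (cyclic \<alpha> \<beta> \<gamma>)
    then show ?case by (simp add: add_ac)
  next
    case (kd f g h)
    show ?case
      using arg_cong [OF br_jacobi [of f g h], of "\<lambda>f. vec (d f)"]
      by (simp add: fbr_kd kd.\<delta>_add kd.\<delta>.zero)
  next
    case (madd \<alpha> \<beta> \<gamma> \<gamma>')
    show ?case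
      using madd(1-4) arg_cong2 [OF madd(5,6), of "(+)"]
      by (simp add: fbr_add_right fbr_add_left algebra_simps)
  next
    case (mscale f \<alpha> \<beta> \<gamma>)
    have "tq_scale f (vec (fbr \<alpha> (fbr \<beta> \<gamma>))) + (tq_scale f (vec (fbr \<beta> (fbr \<gamma> \<alpha>))) +
        tq_scale f (vec (fbr \<gamma> (fbr \<alpha> \<beta>)))) = 0"
      using arg_cong [OF mscale(4), of "tq_scale f"] by (simp add: tq.scale_right_distrib)
    with mscale(1-3) show ?case
      by (simp add: fbr_add_right fbr_scale_right fbr_scale_left \<rho>_fbr \<rho>_minus vec_fbr_skew [of \<gamma> \<alpha>]
           algebra_simps)
  qed
  then show ?thesis
    using assms by (subst vec_inj [symmetric]) simp_all
qed

end


section \<open>The Jacobi identity of an extension\<close>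

definition ext_snd ::
  "('m::ab_group_add \<Rightarrow> 'm \<Rightarrow> 'm) \<Rightarrow> ('x \<Rightarrow> 'm \<Rightarrow> 'm) \<Rightarrow> ('x \<Rightarrow> 'x \<Rightarrow> 'm) \<Rightarrow>
   'x \<Rightarrow> 'm \<Rightarrow> 'x \<Rightarrow> 'm \<Rightarrow> 'm" where
  "ext_snd b D K x \<eta> y \<xi> = D x \<xi> - D y \<eta> + K x y + b \<eta> \<xi>"

text \<open>Collects what the Jacobi identities of both brackets have in common, with
  \<open>x0\<close> as the zero of the first summand. The instances are \<open>C = UNIV\<close> in
  \<open>P_0\<close> and \<open>C = \<Omega>\<close>.\<close>

locale extension_bracket =
  fixes C :: "'x set" and c :: "'x \<Rightarrow> 'x \<Rightarrow> 'x" and x0 :: 'x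
    and b :: "'m::ab_group_add \<Rightarrow> 'm \<Rightarrow> 'm" and D :: "'x \<Rightarrow> 'm \<Rightarrow> 'm" and K :: "'x \<Rightarrow> 'x \<Rightarrow> 'm"
  assumes closed: "x0 \<in> C" "x \<in> C \<Longrightarrow> y \<in> C \<Longrightarrow> c x y \<in> C"
    and c_zero: "x \<in> C \<Longrightarrow> c x0 x = x0" "x \<in> C \<Longrightarrow> c x x0 = x0"
    and b_add: "b (\<eta> + \<xi>) \<zeta> = b \<eta> \<zeta> + b \<xi> \<zeta>" "b \<eta> (\<xi> + \<zeta>) = b \<eta> \<xi> + b \<eta> \<zeta>"
    and b_skew: "b \<eta> \<xi> = - b \<xi> \<eta>"
    and D_add: "x \<in> C \<Longrightarrow> D x (\<eta> + \<xi>) = D x \<eta> + D x \<xi>"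
    and D_zero: "D x0 \<eta> = 0"
    and K_zero: "x \<in> C \<Longrightarrow> K x0 x = 0" "x \<in> C \<Longrightarrow> K x x0 = 0"
begin

abbreviation e :: "'x \<Rightarrow> 'm \<Rightarrow> 'x \<Rightarrow> 'm \<Rightarrow> 'm" where
  "e \<equiv> ext_snd b D K"

lemma b_diff: "b (\<eta> - \<xi>) \<zeta> = b \<eta> \<zeta> - b \<xi> \<zeta>" "b \<eta> (\<xi> - \<zeta>) = b \<eta> \<xi> - b \<eta> \<zeta>"
  using additive.diff [OF additive.intro, of "\<lambda>\<eta>. b \<eta> \<zeta>"] additive.diff [OF additive.intro, of "b \<eta>"]
  by (simp_all add: b_add)

lemma D_diff: "x \<in> C \<Longrightarrow> D x (\<eta> - \<xi>) = D x \<eta> - D x \<xi>"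
  using additive.diff [OF additive.intro, of "D x"] by (simp add: D_add)

lemma b_0 [simp]: "b 0 \<eta> = 0" "b \<eta> 0 = 0"
  using b_diff(1) [of 0 0] b_diff(2) [of _ 0 0] by simp_all

lemma D_0 [simp]: "x \<in> C \<Longrightarrow> D x 0 = 0"
  using D_diff [of _ 0 0] by simp

text \<open>The left-hand side is the \<open>P_1\<close>-component of the Jacobi identity at
  \<open>(x, \<eta>)\<close>, \<open>(y, \<xi>)\<close>, \<open>(z, \<zeta>)\<close>. The number of
  arguments taken from \<open>P_1\<close> separates it: three give the Jacobi identity of
  \<open>b\<close>, two give (1), one gives (2), none gives (3).\<close>

lemma jacobi_iff:
  "(\<forall>x\<in>C. \<forall>y\<in>C. \<forall>z\<in>C. \<forall>\<eta> \<xi> \<zeta>.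
      e x \<eta> (c y z) (e y \<xi> z \<zeta>) + (e y \<xi> (c z x) (e z \<zeta> x \<eta>) + e z \<zeta> (c x y) (e x \<eta> y \<xi>)) = 0) \<longleftrightarrow>
    (\<forall>\<eta> \<xi> \<zeta>. b \<eta> (b \<xi> \<zeta>) + (b \<xi> (b \<zeta> \<eta>) + b \<zeta> (b \<eta> \<xi>)) = 0) \<and>
    (\<forall>x\<in>C. \<forall>\<eta> \<xi>. D x (b \<eta> \<xi>) - b \<eta> (D x \<xi>) = b (D x \<eta>) \<xi>) \<and>
    (\<forall>x\<in>C. \<forall>y\<in>C. \<forall>\<xi>. D x (D y \<xi>) - D y (D x \<xi>) - D (c x y) \<xi> = b (K x y) \<xi>) \<and>
    (\<forall>x\<in>C. \<forall>y\<in>C. \<forall>z\<in>C. (D x (K y z) + K x (c y z)) + (D y (K z x) + K y (c z x)) +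
      (D z (K x y) + K z (c x y)) = 0)"
  (is "?J \<longleftrightarrow> ?Jb \<and> ?D \<and> ?R \<and> ?B")
proof
  assume J: ?J
  note e_simps = ext_snd_def c_zero D_zero K_zero closed
  have ?Jb
    using J closed(1) by (auto simp: e_simps dest!: bspec [of _ _ x0])
  moreover have ?D
  proof (intro ballI allI)
    fix x \<eta> \<xi> assume "x \<in> C"
    then have "D x (b \<eta> \<xi>) + (b \<eta> (- D x \<xi>) + b \<xi> (D x \<eta>)) = 0"
      using J [rule_format, of x x0 x0 0 \<eta> \<xi>] by (simp add: e_simps)
    then show "D x (b \<eta> \<xi>) - b \<eta> (D x \<xi>) = b (D x \<eta>) \<xi>"
      using b_diff(2) [of \<eta> 0] by (simp add: b_skew [of \<xi>] algebra_simps)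
  qed
  moreover have ?R
  proof (intro ballI allI)
    fix x y \<xi> assume "x \<in> C" "y \<in> C"
    then have "D x (D y \<xi>) + (D y (- D x \<xi>) + (b \<xi> (K x y) - D (c x y) \<xi>)) = 0"
      using J [rule_format, of x y x0 0 0 \<xi>] by (simp add: e_simps)
    then show "D x (D y \<xi>) - D y (D x \<xi>) - D (c x y) \<xi> = b (K x y) \<xi>"
      using \<open>y \<in> C\<close> D_diff [of y 0] by (simp add: b_skew [of \<xi>] algebra_simps)
  qed
  moreover have ?B
  proof (intro ballI)
    fix x y z assume "x \<in> C" "y \<in> C" "z \<in> C"
    then show "(D x (K y z) + K x (c y z)) + (D y (K z x) + K y (c z x)) +
        (D z (K x y) + K z (c x y)) = 0"
      using J [rule_format, of x y z 0 0 0] by (simp add: e_simps algebra_simps)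
  qed
  ultimately show "?Jb \<and> ?D \<and> ?R \<and> ?B" by blast
next
  assume "?Jb \<and> ?D \<and> ?R \<and> ?B"
  then have Jb: ?Jb and D: ?D and R: ?R and B: ?B by auto
  \<comment> \<open>Conditions (1) and (2) are oriented so as to eliminate \<open>D\<close> of a
    bracket and \<open>D (c x y)\<close>. What then remains of the Jacobi sum is the sum of the
    identities \<open>1\<close> and \<open>2\<close> below.\<close>
  have D: "D x (b \<eta> \<xi>) = b \<eta> (D x \<xi>) - b \<xi> (D x \<eta>)" if "x \<in> C" for x \<eta> \<xi>
    using that D [rule_format, of x \<eta> \<xi>] by (simp add: b_skew [of "D x \<eta>"] algebra_simps)
  have R: "D (c x y) \<xi> = D x (D y \<xi>) - D y (D x \<xi>) + b \<xi> (K x y)"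
    if "x \<in> C" "y \<in> C" for x y \<xi>
    using that R [rule_format, of x y \<xi>] by (simp add: b_skew [of "K x y"] algebra_simps)
  show ?J
  proof (intro ballI allI)
    fix x y z \<eta> \<xi> \<zeta> assume C: "x \<in> C" "y \<in> C" "z \<in> C"
    have 1: "b \<eta> (b \<xi> \<zeta>) + (b \<xi> (b \<zeta> \<eta>) + b \<zeta> (b \<eta> \<xi>)) = 0"
      using Jb by blast
    have 2: "(D x (K y z) + K x (c y z)) + (D y (K z x) + K y (c z x)) + (D z (K x y) + K z (c x y)) = 0"
      using B C by blast
    show "e x \<eta> (c y z) (e y \<xi> z \<zeta>) + (e y \<xi> (c z x) (e z \<zeta> x \<eta>) + e z \<zeta> (c x y) (e x \<eta> y \<xi>)) = 0"
      using arg_cong2 [OF 1 2, of "(+)"] C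
      by (simp add: ext_snd_def D R D_add D_diff b_add b_diff algebra_simps)
  qed
qed

end


section \<open>Poisson triples\<close>

locale poisson_extension = poisson_algebra s alt br + M: module act
  for s :: "'r::comm_ring_1 \<Rightarrow> 'a::comm_ring_1 \<Rightarrow> 'a" and alt :: bool and br :: "'a \<Rightarrow> 'a \<Rightarrow> 'a"
    and act :: "'a \<Rightarrow> 'm::ab_group_add \<Rightarrow> 'm" +
  assumes faithful: "faithful (whole act)"
begin

text \<open>Linearity is demanded in the second argument only; skewness supplies it in the
  first.\<close>

definition linear_skew :: "('m \<Rightarrow> 'm \<Rightarrow> 'm) \<Rightarrow> bool" where
  "linear_skew b \<longleftrightarrow>
    (\<forall>\<eta> \<xi> \<zeta>. b \<eta> (\<xi> + \<zeta>) = b \<eta> \<xi> + b \<eta> \<zeta>) \<and> (\<forall>f \<eta> \<xi>. b \<eta> (act f \<xi>) = act f (b \<eta> \<xi>)) \<and>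
    (\<forall>\<eta> \<xi>. b \<eta> \<xi> + b \<xi> \<eta> = 0) \<and> (alt \<longrightarrow> (\<forall>\<eta>. b \<eta> \<eta> = 0))"

lemma linear_skewD:
  assumes "linear_skew b"
  shows "b \<eta> (\<xi> + \<zeta>) = b \<eta> \<xi> + b \<eta> \<zeta>" "b \<eta> (act f \<xi>) = act f (b \<eta> \<xi>)" "b \<eta> \<xi> = - b \<xi> \<eta>"
    "alt \<Longrightarrow> b \<eta> \<eta> = 0" "b (\<eta> + \<xi>) \<zeta> = b \<eta> \<zeta> + b \<xi> \<zeta>" "b (act f \<eta>) \<xi> = act f (b \<eta> \<xi>)"
proof -
  show "b \<eta> (\<xi> + \<zeta>) = b \<eta> \<xi> + b \<eta> \<zeta>" "b \<eta> (act f \<xi>) = act f (b \<eta> \<xi>)" "b \<eta> \<xi> = - b \<xi> \<eta>"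
    "alt \<Longrightarrow> b \<eta> \<eta> = 0" for \<eta> \<xi> \<zeta> f
    using assms unfolding linear_skew_def eq_neg_iff_add_eq_0 by blast+
  then show "b (\<eta> + \<xi>) \<zeta> = b \<eta> \<zeta> + b \<xi> \<zeta>" "b (act f \<eta>) \<xi> = act f (b \<eta> \<xi>)"
    by (metis minus_add_distrib, metis M.scale_minus_right)
qed

lemma lie_bracket_iff:
  "lie_bracket alt (whole act) b \<longleftrightarrow>
    linear_skew b \<and> (\<forall>\<eta> \<xi> \<zeta>. b \<eta> (b \<xi> \<zeta>) + (b \<xi> (b \<zeta> \<eta>) + b \<zeta> (b \<eta> \<xi>)) = 0)"
proof -
  have "bilinear_map (whole act) (whole act) (whole act) b \<and> skew_symmetric alt (whole act) (whole act) b
    \<longleftrightarrow> linear_skew b"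
  proof
    assume "linear_skew b"
    note b = linear_skewD(1,2,5,6) [OF this]
    from \<open>linear_skew b\<close> show "bilinear_map (whole act) (whole act) (whole act) b \<and> skew_symmetric alt (whole act) (whole act) b"
      by (simp add: bilinear_map_def linear_map_def skew_symmetric_def whole_def b)
        (simp add: linear_skew_def)
  qed (simp add: linear_skew_def bilinear_map_def linear_map_def skew_symmetric_def whole_def)
  then show ?thesis
    by (auto simp: lie_bracket_def whole_def)
qed

definition contravariant :: "('a form \<Rightarrow> 'm \<Rightarrow> 'm) \<Rightarrow> bool" where
  "contravariant D \<longleftrightarrow> D \<in> extensional \<Omega> \<and>
    (\<forall>\<alpha>\<in>\<Omega>. \<forall>\<eta> \<xi>. D \<alpha> (\<eta> + \<xi>) = D \<alpha> \<eta> + D \<alpha> \<xi>) \<and>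
    (\<forall>\<alpha>\<in>\<Omega>. \<forall>\<beta>\<in>\<Omega>. \<forall>\<eta>. D (\<alpha> \<oplus> \<beta>) \<eta> = D \<alpha> \<eta> + D \<beta> \<eta>) \<and>
    (\<forall>\<alpha>\<in>\<Omega>. \<forall>f \<eta>. D (f \<odot> \<alpha>) \<eta> = act f (D \<alpha> \<eta>)) \<and>
    (\<forall>\<alpha>\<in>\<Omega>. \<forall>f \<eta>. D \<alpha> (act f \<eta>) = act f (D \<alpha> \<eta>) + act (\<rho> \<alpha> f) \<eta>)"

lemma contravariantD:
  assumes "contravariant D" "\<alpha> \<in> \<Omega>"
  shows "D \<alpha> (\<eta> + \<xi>) = D \<alpha> \<eta> + D \<alpha> \<xi>" "\<beta> \<in> \<Omega> \<Longrightarrow> D (\<alpha> \<oplus> \<beta>) \<eta> = D \<alpha> \<eta> + D \<beta> \<eta>"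
    "D (f \<odot> \<alpha>) \<eta> = act f (D \<alpha> \<eta>)" "D \<alpha> (act f \<eta>) = act f (D \<alpha> \<eta>) + act (\<rho> \<alpha> f) \<eta>"
  using assms unfolding contravariant_def by blast+

text \<open>\<open>R\<close>-linearity is absorbed by the rules for \<open>f\<close>: for
  \<open>f = s r 1\<close> the anchor term is zero, since derivations vanish on constants.\<close>

lemma contravariant_derivative_iff: "contravariant_derivative s br act D \<longleftrightarrow> contravariant D"
  by (auto simp: contravariant_derivative_def contravariant_def bilinear_map_def linear_map_def
      restrict_scalars_def whole_def PiE_def \<rho>_one)

definition form_pairing :: "('a form \<Rightarrow> 'a form \<Rightarrow> 'm) \<Rightarrow> bool" where
  "form_pairing K \<longleftrightarrow> K \<in> \<Omega> \<rightarrow>\<^sub>E \<Omega> \<rightarrow>\<^sub>E UNIV \<and>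
    (\<forall>\<alpha>\<in>\<Omega>. \<forall>\<beta>\<in>\<Omega>. \<forall>\<gamma>\<in>\<Omega>. K \<alpha> (\<beta> \<oplus> \<gamma>) = K \<alpha> \<beta> + K \<alpha> \<gamma>) \<and>
    (\<forall>\<alpha>\<in>\<Omega>. \<forall>\<beta>\<in>\<Omega>. \<forall>f. K \<alpha> (f \<odot> \<beta>) = act f (K \<alpha> \<beta>)) \<and>
    (\<forall>\<alpha>\<in>\<Omega>. \<forall>\<beta>\<in>\<Omega>. K \<alpha> \<beta> + K \<beta> \<alpha> = 0) \<and> (alt \<longrightarrow> (\<forall>\<alpha>\<in>\<Omega>. K \<alpha> \<alpha> = 0))"

lemma form_pairingD:
  assumes "form_pairing K" "\<alpha> \<in> \<Omega>" "\<beta> \<in> \<Omega>"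
  shows "\<gamma> \<in> \<Omega> \<Longrightarrow> K \<alpha> (\<beta> \<oplus> \<gamma>) = K \<alpha> \<beta> + K \<alpha> \<gamma>" "K \<alpha> (f \<odot> \<beta>) = act f (K \<alpha> \<beta>)"
    "K \<alpha> \<beta> = - K \<beta> \<alpha>" "alt \<Longrightarrow> K \<alpha> \<alpha> = 0"
    "\<gamma> \<in> \<Omega> \<Longrightarrow> K (\<alpha> \<oplus> \<beta>) \<gamma> = K \<alpha> \<gamma> + K \<beta> \<gamma>" "K (f \<odot> \<alpha>) \<beta> = act f (K \<alpha> \<beta>)"
proof -
  have K: "\<alpha> \<in> \<Omega> \<Longrightarrow> \<beta> \<in> \<Omega> \<Longrightarrow> \<gamma> \<in> \<Omega> \<Longrightarrow> K \<alpha> (\<beta> \<oplus> \<gamma>) = K \<alpha> \<beta> + K \<alpha> \<gamma>"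
    "\<alpha> \<in> \<Omega> \<Longrightarrow> \<beta> \<in> \<Omega> \<Longrightarrow> K \<alpha> (f \<odot> \<beta>) = act f (K \<alpha> \<beta>)"
    "\<alpha> \<in> \<Omega> \<Longrightarrow> \<beta> \<in> \<Omega> \<Longrightarrow> K \<alpha> \<beta> = - K \<beta> \<alpha>" "alt \<Longrightarrow> \<alpha> \<in> \<Omega> \<Longrightarrow> K \<alpha> \<alpha> = 0" for \<alpha> \<beta> \<gamma> f
    using assms(1) [unfolded form_pairing_def] by (simp_all add: eq_neg_iff_add_eq_0)
  show "\<gamma> \<in> \<Omega> \<Longrightarrow> K \<alpha> (\<beta> \<oplus> \<gamma>) = K \<alpha> \<beta> + K \<alpha> \<gamma>" "K \<alpha> (f \<odot> \<beta>) = act f (K \<alpha> \<beta>)"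
    "K \<alpha> \<beta> = - K \<beta> \<alpha>" "alt \<Longrightarrow> K \<alpha> \<alpha> = 0"
    by (rule K; (rule assms(2,3) | assumption))+
  show "K (\<alpha> \<oplus> \<beta>) \<gamma> = K \<alpha> \<gamma> + K \<beta> \<gamma>" if "\<gamma> \<in> \<Omega>"
    using assms(2,3) that by (simp add: K(3) [of "\<alpha> \<oplus> \<beta>"] K(3) [of \<alpha> \<gamma>] K(3) [of \<beta> \<gamma>] K(1))
  show "K (f \<odot> \<alpha>) \<beta> = act f (K \<alpha> \<beta>)"
    using assms(2,3) by (simp add: K(3) [of "f \<odot> \<alpha>"] K(3) [of \<alpha> \<beta>] K(2))
qed

lemma form_pairing_iff:
  "bilinear_map (Omega s) (Omega s) (whole act) K \<and> skew_symmetric alt (Omega s) (whole act) K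
    \<longleftrightarrow> form_pairing K"
proof
  assume K: "form_pairing K"
  show "bilinear_map (Omega s) (Omega s) (whole act) K \<and> skew_symmetric alt (Omega s) (whole act) K"
    using K
    by (simp add: bilinear_map_def linear_map_def skew_symmetric_def whole_def
        form_pairingD(1,2,5,6) [OF K]) (simp add: form_pairing_def)
qed (simp add: form_pairing_def bilinear_map_def linear_map_def skew_symmetric_def whole_def)

text \<open>The last four conditions are arranged as the right-hand side of
  \<open>jacobi_iff\<close>.\<close>

lemma poisson_triples_iff:
  "(b, D, K) \<in> poisson_triples alt s br act \<longleftrightarrow> linear_skew b \<and> contravariant D \<and> form_pairing K \<and>
    (\<forall>\<eta> \<xi> \<zeta>. b \<eta> (b \<xi> \<zeta>) + (b \<xi> (b \<zeta> \<eta>) + b \<zeta> (b \<eta> \<xi>)) = 0) \<and>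
    (\<forall>\<alpha>\<in>\<Omega>. \<forall>\<eta> \<xi>. D \<alpha> (b \<eta> \<xi>) - b \<eta> (D \<alpha> \<xi>) = b (D \<alpha> \<eta>) \<xi>) \<and>
    (\<forall>\<alpha>\<in>\<Omega>. \<forall>\<beta>\<in>\<Omega>. \<forall>\<xi>. D \<alpha> (D \<beta> \<xi>) - D \<beta> (D \<alpha> \<xi>) - D (fbr \<alpha> \<beta>) \<xi> = b (K \<alpha> \<beta>) \<xi>) \<and>
    (\<forall>\<alpha>\<in>\<Omega>. \<forall>\<beta>\<in>\<Omega>. \<forall>\<gamma>\<in>\<Omega>. (D \<alpha> (K \<beta> \<gamma>) + K \<alpha> (fbr \<beta> \<gamma>)) + (D \<beta> (K \<gamma> \<alpha>) + K \<beta> (fbr \<gamma> \<alpha>)) +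
      (D \<gamma> (K \<alpha> \<beta>) + K \<gamma> (fbr \<alpha> \<beta>)) = 0)"
  unfolding poisson_triples_def
  by (simp add: lie_bracket_iff contravariant_derivative_iff flip: form_pairing_iff) blast

lemma Omega_zero: "\<zero> = 0 \<odot> d 0"
  by (subst vec_inj [symmetric]) simp_all

lemma fbr_zero [simp]: "\<alpha> \<in> \<Omega> \<Longrightarrow> fbr \<alpha> \<zero> = \<zero>" "\<alpha> \<in> \<Omega> \<Longrightarrow> fbr \<zero> \<alpha> = \<zero>"
  by (subst vec_inj [symmetric]; simp add: Omega_zero vec_fbr_scale_right vec_fbr_skew [of _ \<alpha>])+

lemma contravariant_zero: "contravariant D \<Longrightarrow> D \<zero> \<eta> = 0"
  by (simp add: Omega_zero contravariantD)

lemma form_pairing_zero: "form_pairing K \<Longrightarrow> \<alpha> \<in> \<Omega> \<Longrightarrow> K \<zero> \<alpha> = 0" "form_pairing K \<Longrightarrow> \<alpha> \<in> \<Omega> \<Longrightarrow> K \<alpha> \<zero> = 0"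
  by (simp_all add: Omega_zero form_pairingD(2,6))

lemma extension_bracket_Omega:
  assumes "linear_skew b" "contravariant D" "form_pairing K"
  shows "extension_bracket \<Omega> fbr \<zero> b D K"
proof
  show "b \<eta> \<xi> = - b \<xi> \<eta>" for \<eta> \<xi>
    by (rule linear_skewD) fact
qed (simp_all add: linear_skewD(1,5) [OF assms(1)] contravariantD(1) [OF assms(2)]
    contravariant_zero [OF assms(2)] form_pairing_zero [OF assms(3)])


section \<open>Poisson structures on the trivial extension algebra\<close>

lemma triv_ext_eq:
  "triv_ext s act =
    \<lparr>carrier = UNIV, madd = (+), mzero = 0, mscale = (\<lambda>r x. (s r 1 * fst x, act (s r 1) (snd x)))\<rparr>"
  by (simp add: triv_ext_def restrict_scalars_def direct_sum_def whole_def fun_eq_iff prod_eq_iff)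

text \<open>The \<open>P_0\<close>-component of each axiom is an axiom of \<open>br\<close>, so only
  the \<open>P_1\<close>-components remain; linearity in the first argument is recovered from
  skewness.\<close>

lemma ext_poisson_structures_iff:
  "B \<in> ext_poisson_structures alt s br act \<longleftrightarrow>
    (\<forall>f \<eta> g \<xi>. fst (B (f, \<eta>) (g, \<xi>)) = br f g) \<and>
    (\<forall>f \<eta> g \<xi> h \<zeta>. snd (B (f, \<eta>) (g + h, \<xi> + \<zeta>)) = snd (B (f, \<eta>) (g, \<xi>)) + snd (B (f, \<eta>) (h, \<zeta>))) \<and>
    (\<forall>f \<eta> g \<xi> r. snd (B (f, \<eta>) (s r g, act (s r 1) \<xi>)) = act (s r 1) (snd (B (f, \<eta>) (g, \<xi>)))) \<and>
    (\<forall>f \<eta> g \<xi>. snd (B (f, \<eta>) (g, \<xi>)) + snd (B (g, \<xi>) (f, \<eta>)) = 0) \<and>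
    (alt \<longrightarrow> (\<forall>f \<eta>. snd (B (f, \<eta>) (f, \<eta>)) = 0)) \<and>
    (\<forall>f \<eta> g \<xi> h \<zeta>. snd (B (f, \<eta>) (br g h, snd (B (g, \<xi>) (h, \<zeta>)))) +
      (snd (B (g, \<xi>) (br h f, snd (B (h, \<zeta>) (f, \<eta>)))) +
       snd (B (h, \<zeta>) (br f g, snd (B (f, \<eta>) (g, \<xi>))))) = 0) \<and>
    (\<forall>f \<eta> g \<xi> h \<zeta>. snd (B (f, \<eta>) (g * h, act g \<zeta> + act h \<xi>)) =
      (act (br f g) \<zeta> + act h (snd (B (f, \<eta>) (g, \<xi>)))) + (act g (snd (B (f, \<eta>) (h, \<zeta>))) + act (br f h) \<xi>))"
  (is "_ \<longleftrightarrow> ?fst \<and> ?add \<and> ?scale \<and> ?skew \<and> ?alt \<and> ?jacobi \<and> ?leibniz")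
proof -
  have *: "poisson_structure alt (triv_ext s act) (triv_ext_mult act) B \<longleftrightarrow>
    ?add \<and> ?scale \<and> ?skew \<and> ?alt \<and> ?jacobi \<and> ?leibniz" if fst: ?fst
  proof -
    define T where "T f \<eta> g \<xi> = snd (B (f, \<eta>) (g, \<xi>))" for f \<eta> g \<xi>
    have B: "B = (\<lambda>(f, \<eta>) (g, \<xi>). (br f g, T f \<eta> g \<xi>))"
      using fst by (simp add: T_def fun_eq_iff prod_eq_iff)
    have left: "T (g + h) (\<xi> + \<zeta>) f \<eta> = T g \<xi> f \<eta> + T h \<zeta> f \<eta>"
        "T (s r g) (act (s r 1) \<xi>) f \<eta> = act (s r 1) (T g \<xi> f \<eta>)"
      if "?add" "?scale" "?skew" for f g h \<xi> \<zeta> \<eta> r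
    proof -
      have skew: "T x \<alpha> y \<beta> = - T y \<beta> x \<alpha>" for x \<alpha> y \<beta>
        using \<open>?skew\<close> by (simp add: T_def eq_neg_iff_add_eq_0)
      show "T (g + h) (\<xi> + \<zeta>) f \<eta> = T g \<xi> f \<eta> + T h \<zeta> f \<eta>"
        using \<open>?add\<close> by (simp add: skew [of _ _ f \<eta>] T_def [of f \<eta>])
      show "T (s r g) (act (s r 1) \<xi>) f \<eta> = act (s r 1) (T g \<xi> f \<eta>)"
        using \<open>?scale\<close> by (simp add: skew [of _ _ f \<eta>] T_def [of f \<eta>])
    qed
    have br_skew': "br f g + br g f = 0" for f g
      using br_skew [of f g] by simp
    show ?thesis
      using left unfolding poisson_structure_def lie_bracket_def bilinear_map_def linear_map_def
        skew_symmetric_def triv_ext_mult_def T_def [symmetric] B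
      by (auto simp: triv_ext_eq zero_prod_def br_add br_scale br_skew' br_alt br_mult br_jacobi
          scale_eq [symmetric])
  qed
  show ?thesis
  proof (cases ?fst)
    case True
    then show ?thesis
      by (simp only: ext_poisson_structures_def mem_Collect_eq * [OF True] simp_thms)
  next
    case False
    then show ?thesis
      by (simp only: ext_poisson_structures_def mem_Collect_eq simp_thms)
  qed
qed

section \<open>Poisson triples on exact forms\<close>

definition derivation_family :: "('a \<Rightarrow> 'm \<Rightarrow> 'm) \<Rightarrow> bool" where
  "derivation_family \<delta> \<longleftrightarrow>
    (\<forall>f g \<xi>. \<delta> (f + g) \<xi> = \<delta> f \<xi> + \<delta> g \<xi>) \<and>
    (\<forall>f g \<xi>. \<delta> (f * g) \<xi> = act f (\<delta> g \<xi>) + act g (\<delta> f \<xi>)) \<and>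
    (\<forall>r f \<xi>. \<delta> (s r f) \<xi> = act (s r 1) (\<delta> f \<xi>)) \<and>
    (\<forall>f \<eta> \<xi>. \<delta> f (\<eta> + \<xi>) = \<delta> f \<eta> + \<delta> f \<xi>) \<and>
    (\<forall>f g \<xi>. \<delta> f (act g \<xi>) = act g (\<delta> f \<xi>) + act (br f g) \<xi>)"

definition skew_biderivation :: "('a \<Rightarrow> 'a \<Rightarrow> 'm) \<Rightarrow> bool" where
  "skew_biderivation \<kappa> \<longleftrightarrow>
    (\<forall>f g h. \<kappa> f (g + h) = \<kappa> f g + \<kappa> f h) \<and>
    (\<forall>f g h. \<kappa> f (g * h) = act g (\<kappa> f h) + act h (\<kappa> f g)) \<and>
    (\<forall>r f g. \<kappa> f (s r g) = act (s r 1) (\<kappa> f g)) \<and>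
    (\<forall>f g. \<kappa> f g + \<kappa> g f = 0) \<and> (alt \<longrightarrow> (\<forall>f. \<kappa> f f = 0))"

lemma derivation_familyD:
  assumes "derivation_family \<delta>"
  shows "\<delta> (f + g) \<xi> = \<delta> f \<xi> + \<delta> g \<xi>" "\<delta> (f * g) \<xi> = act f (\<delta> g \<xi>) + act g (\<delta> f \<xi>)"
    "\<delta> (s r f) \<xi> = act (s r 1) (\<delta> f \<xi>)" "\<delta> f (\<eta> + \<xi>) = \<delta> f \<eta> + \<delta> f \<xi>"
    "\<delta> f (act g \<xi>) = act g (\<delta> f \<xi>) + act (br f g) \<xi>" "\<delta> 0 \<xi> = 0"
proof -
  show "\<delta> (f + g) \<xi> = \<delta> f \<xi> + \<delta> g \<xi>" for f g
    using assms unfolding derivation_family_def by blast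
  from this [of 0 0] show "\<delta> 0 \<xi> = 0"
    by simp
qed (use assms in \<open>unfold derivation_family_def, blast+\<close>)

lemma skew_biderivationD:
  assumes "skew_biderivation \<kappa>"
  shows "\<kappa> f (g + h) = \<kappa> f g + \<kappa> f h" "\<kappa> f (g * h) = act g (\<kappa> f h) + act h (\<kappa> f g)"
    "\<kappa> f (s r g) = act (s r 1) (\<kappa> f g)" "\<kappa> f g = - \<kappa> g f" "alt \<Longrightarrow> \<kappa> f f = 0"
    "\<kappa> f 0 = 0" "\<kappa> 0 f = 0"
proof -
  show add: "\<kappa> f (g + h) = \<kappa> f g + \<kappa> f h" for f g h
    using assms unfolding skew_biderivation_def by blast
  show skew: "\<kappa> f g = - \<kappa> g f" for f g
    using assms by (simp add: skew_biderivation_def eq_neg_iff_add_eq_0)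
  from add [of f 0 0] show "\<kappa> f 0 = 0"
    by simp
  with skew [of 0 f] show "\<kappa> 0 f = 0"
    by simp
qed (use assms in \<open>unfold skew_biderivation_def, blast+\<close>)

text \<open>What a Poisson triple becomes on exact forms, with \<open>\<delta> f = D (d f)\<close>
  and \<open>\<kappa> f g = K (d f) (d g)\<close>. A Poisson bracket on the trivial extension sees
  just these data; lifting them to \<Omega> is a separate step.\<close>

definition infinitesimal_triple ::
  "('m \<Rightarrow> 'm \<Rightarrow> 'm) \<Rightarrow> ('a \<Rightarrow> 'm \<Rightarrow> 'm) \<Rightarrow> ('a \<Rightarrow> 'a \<Rightarrow> 'm) \<Rightarrow> bool" where
  "infinitesimal_triple b \<delta> \<kappa> \<longleftrightarrow> linear_skew b \<and> derivation_family \<delta> \<and> skew_biderivation \<kappa> \<and>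
    (\<forall>\<eta> \<xi> \<zeta>. b \<eta> (b \<xi> \<zeta>) + (b \<xi> (b \<zeta> \<eta>) + b \<zeta> (b \<eta> \<xi>)) = 0) \<and>
    (\<forall>f \<eta> \<xi>. \<delta> f (b \<eta> \<xi>) - b \<eta> (\<delta> f \<xi>) = b (\<delta> f \<eta>) \<xi>) \<and>
    (\<forall>f g \<xi>. \<delta> f (\<delta> g \<xi>) - \<delta> g (\<delta> f \<xi>) - \<delta> (br f g) \<xi> = b (\<kappa> f g) \<xi>) \<and>
    (\<forall>f g h. (\<delta> f (\<kappa> g h) + \<kappa> f (br g h)) + (\<delta> g (\<kappa> h f) + \<kappa> g (br h f)) +
      (\<delta> h (\<kappa> f g) + \<kappa> h (br f g)) = 0)"

definition ext_bracket ::
  "('m \<Rightarrow> 'm \<Rightarrow> 'm) \<Rightarrow> ('a \<Rightarrow> 'm \<Rightarrow> 'm) \<Rightarrow> ('a \<Rightarrow> 'a \<Rightarrow> 'm) \<Rightarrow> 'a \<times> 'm \<Rightarrow> 'a \<times> 'm \<Rightarrow> 'a \<times> 'm" where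
  "ext_bracket b \<delta> \<kappa> = (\<lambda>(f, \<eta>) (g, \<xi>). (br f g, ext_snd b \<delta> \<kappa> f \<eta> g \<xi>))"

lemma poisson_of_triple_eq:
  "poisson_of_triple s br (b, D, K) = ext_bracket b (\<lambda>f. D (d f)) (\<lambda>f g. K (d f) (d g))"
  by (simp add: poisson_of_triple_def ext_bracket_def ext_snd_def)

lemma br_zero: "br f 0 = 0" "br 0 f = 0"
  using br_add(2) [of f 0 0] br_add(1) [of 0 0 f] by simp_all

text \<open>Constants are Casimirs. For them the Leibniz rule of \<open>\<delta>\<close> in its
  module argument becomes \<open>R\<close>-linearity.\<close>

lemma br_unit: "br f (s r 1) = 0"
  using \<rho>_one [of "d f"] by simp

lemma extension_bracket_UNIV:
  assumes "linear_skew b" "derivation_family \<delta>" "skew_biderivation \<kappa>"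
  shows "extension_bracket UNIV br 0 b \<delta> \<kappa>"
proof
  show "b \<eta> \<xi> = - b \<xi> \<eta>" for \<eta> \<xi>
    by (rule linear_skewD) fact
qed (simp_all add: br_zero linear_skewD(1,5) [OF assms(1)] derivation_familyD(4,6) [OF assms(2)]
    skew_biderivationD(6,7) [OF assms(3)])

lemma ext_bracket_poisson:
  assumes "infinitesimal_triple b \<delta> \<kappa>"
  shows "ext_bracket b \<delta> \<kappa> \<in> ext_poisson_structures alt s br act"
proof -
  have b: "linear_skew b" and \<delta>: "derivation_family \<delta>" and \<kappa>: "skew_biderivation \<kappa>"
    using assms by (auto simp: infinitesimal_triple_def)
  interpret E: extension_bracket UNIV br 0 b \<delta> \<kappa>
    by (rule extension_bracket_UNIV) fact+
  have snd: "snd (ext_bracket b \<delta> \<kappa> (f, \<eta>) (g, \<xi>)) = E.e f \<eta> g \<xi>" for f \<eta> g \<xi>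
    by (simp add: ext_bracket_def)
  have fst: "fst (ext_bracket b \<delta> \<kappa> (f, \<eta>) (g, \<xi>)) = br f g" for f \<eta> g \<xi>
    by (simp add: ext_bracket_def)
  show ?thesis
    unfolding ext_poisson_structures_iff snd fst
  proof (intro conjI)
    show "\<forall>f \<eta> g \<xi>. E.e f \<eta> g \<xi> + E.e g \<xi> f \<eta> = 0"
    proof (intro allI)
      fix f \<eta> g \<xi>
      show "E.e f \<eta> g \<xi> + E.e g \<xi> f \<eta> = 0"
        using linear_skewD(3) [OF b, of \<eta> \<xi>] skew_biderivationD(4) [OF \<kappa>, of f g] by (simp add: ext_snd_def)
    qed
    show "\<forall>f \<eta> g \<xi> h \<zeta>. E.e f \<eta> (br g h) (E.e g \<xi> h \<zeta>) +
      (E.e g \<xi> (br h f) (E.e h \<zeta> f \<eta>) + E.e h \<zeta> (br f g) (E.e f \<eta> g \<xi>)) = 0"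
      using E.jacobi_iff assms unfolding infinitesimal_triple_def by auto
  qed (use linear_skewD(4) [OF b] skew_biderivationD(5) [OF \<kappa>] in
      \<open>auto simp: ext_snd_def linear_skewD(1,2) [OF b] derivation_familyD(1-5) [OF \<delta>]
        skew_biderivationD(1-3) [OF \<kappa>] br_unit algebra_simps\<close>)
qed

text \<open>The components are the restrictions of the bracket to \<open>P_1 \<times> P_1\<close>,
  \<open>P_0 \<times> P_1\<close> and \<open>P_0 \<times> P_0\<close>. Their product rules come from
  the Leibniz rule on \<open>(f, 0) (0, \<xi>) = (0, f \<xi>)\<close> and
  \<open>(f, 0) (g, 0) = (f g, 0)\<close>.\<close>

lemma ext_poisson_structures_cases:
  assumes "B \<in> ext_poisson_structures alt s br act"
  obtains b \<delta> \<kappa> where "infinitesimal_triple b \<delta> \<kappa>" "B = ext_bracket b \<delta> \<kappa>"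
proof -
  note B = assms [unfolded ext_poisson_structures_iff]
  let ?b = "\<lambda>\<eta> \<xi>. snd (B (0, \<eta>) (0, \<xi>))" and ?\<delta> = "\<lambda>f \<xi>. snd (B (f, 0) (0, \<xi>))"
    and ?\<kappa> = "\<lambda>f g. snd (B (f, 0) (g, 0))"
  note fst = B [THEN conjunct1, rule_format]
    and add = B [THEN conjunct2, THEN conjunct1, rule_format]
    and scale = B [THEN conjunct2, THEN conjunct2, THEN conjunct1, rule_format]
  have skew: "snd (B (f, \<eta>) (g, \<xi>)) = - snd (B (g, \<xi>) (f, \<eta>))" for f \<eta> g \<xi>
    using B by (simp add: eq_neg_iff_add_eq_0)
  have alt: "alt \<Longrightarrow> snd (B (f, \<eta>) (f, \<eta>)) = 0" for f \<eta>
    using B by auto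
  have leibniz: "snd (B (f, \<eta>) (g * h, act g \<zeta> + act h \<xi>)) =
      (act (br f g) \<zeta> + act h (snd (B (f, \<eta>) (g, \<xi>)))) + (act g (snd (B (f, \<eta>) (h, \<zeta>))) + act (br f h) \<xi>)"
    for f \<eta> g \<xi> h \<zeta>
    using B by auto
  have b: "linear_skew ?b"
    unfolding linear_skew_def
  proof (intro conjI allI impI)
    fix f \<eta> \<xi> \<zeta>
    show "?b \<eta> (\<xi> + \<zeta>) = ?b \<eta> \<xi> + ?b \<eta> \<zeta>"
      using add [of 0 \<eta> 0 0 \<xi> \<zeta>] by simp
    show "?b \<eta> (act f \<xi>) = act f (?b \<eta> \<xi>)"
      \<comment> \<open>The product is \<open>(f, 0) (0, \<xi>)\<close>; its anchor term
        \<open>{0, f} \<xi>\<close> vanishes, which leaves linearity.\<close>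
      using leibniz [of 0 \<eta> f 0 \<xi> 0] by (simp add: br_zero)
    show "?b \<eta> \<xi> + ?b \<xi> \<eta> = 0"
      by (simp add: skew [of 0 \<eta>])
  qed (rule alt)
  have \<delta>: "derivation_family ?\<delta>"
    unfolding derivation_family_def
  proof (intro conjI allI)
    fix f g r \<eta> \<xi>
    show "?\<delta> (f + g) \<xi> = ?\<delta> f \<xi> + ?\<delta> g \<xi>"
      using add [of 0 \<xi> f g 0 0] by (simp add: skew [of _ _ 0 \<xi>])
    show "?\<delta> (f * g) \<xi> = act f (?\<delta> g \<xi>) + act g (?\<delta> f \<xi>)"
      \<comment> \<open>Here \<open>(0, \<xi>)\<close> is bracketed with
        \<open>(f, 0) (g, 0)\<close>; skewness moves the product rule into the first argument of
        \<open>\<delta>\<close>.\<close>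
      using leibniz [of 0 \<xi> f g 0 0] by (simp add: skew [of _ _ 0 \<xi>])
    show "?\<delta> (s r f) \<xi> = act (s r 1) (?\<delta> f \<xi>)"
      using scale [of 0 \<xi> r f 0] by (simp add: skew [of _ _ 0 \<xi>])
    show "?\<delta> f (\<eta> + \<xi>) = ?\<delta> f \<eta> + ?\<delta> f \<xi>"
      using add [of f 0 0 0 \<eta> \<xi>] by simp
    show "?\<delta> f (act g \<xi>) = act g (?\<delta> f \<xi>) + act (br f g) \<xi>"
      using leibniz [of f 0 g 0 \<xi> 0] by (simp add: br_zero)
  qed
  have \<kappa>: "skew_biderivation ?\<kappa>"
    unfolding skew_biderivation_def
  proof (intro conjI allI impI)
    fix f g h r
    show "?\<kappa> f (g + h) = ?\<kappa> f g + ?\<kappa> f h"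
      using add [of f 0 g h 0 0] by simp
    show "?\<kappa> f (g * h) = act g (?\<kappa> f h) + act h (?\<kappa> f g)"
      using leibniz [of f 0 g h 0 0] by simp
    show "?\<kappa> f (s r g) = act (s r 1) (?\<kappa> f g)"
      using scale [of f 0 r g 0] by simp
    show "?\<kappa> f g + ?\<kappa> g f = 0"
      by (simp add: skew [of f])
  qed (rule alt)
  have e: "snd (B (f, \<eta>) (g, \<xi>)) = ?\<delta> f \<xi> - ?\<delta> g \<eta> + ?\<kappa> f g + ?b \<eta> \<xi>" for f \<eta> g \<xi>
  proof -
    \<comment> \<open>Additivity is at hand only in the second argument, hence the swap before the
      first pair is split.\<close>
    have "snd (B (f, \<eta>) (g, \<xi>)) = - snd (B (g, 0) (f, \<eta>)) - snd (B (0, \<xi>) (f, \<eta>))"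
      using add [of f \<eta> g 0 0 \<xi>] skew [of f \<eta> g 0] skew [of f \<eta> 0 \<xi>] by simp
    also have "\<dots> = - (snd (B (g, 0) (f, 0)) + ?\<delta> g \<eta>) - (snd (B (0, \<xi>) (f, 0)) + snd (B (0, \<xi>) (0, \<eta>)))"
      using add [of g 0 f 0 0 \<eta>] add [of 0 \<xi> f 0 0 \<eta>] by simp
    finally show ?thesis
      using skew [of g 0 f 0] skew [of 0 \<xi> f 0] skew [of 0 \<xi> 0 \<eta>] by (simp add: algebra_simps)
  qed
  obtain b \<delta> \<kappa> where defs: "b = ?b" "\<delta> = ?\<delta>" "\<kappa> = ?\<kappa>"
    by blast
  have b': "linear_skew b" and \<delta>': "derivation_family \<delta>" and \<kappa>': "skew_biderivation \<kappa>"
    using b \<delta> \<kappa> by (simp_all only: defs)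
  have snd: "snd (B (f, \<eta>) (g, \<xi>)) = ext_snd b \<delta> \<kappa> f \<eta> g \<xi>" for f \<eta> g \<xi>
    unfolding defs ext_snd_def by (rule e)
  interpret E: extension_bracket UNIV br 0 b \<delta> \<kappa>
    by (rule extension_bracket_UNIV) fact+
  have "infinitesimal_triple b \<delta> \<kappa>"
    using B E.jacobi_iff b' \<delta>' \<kappa>' unfolding infinitesimal_triple_def snd by auto
  moreover have "B = ext_bracket b \<delta> \<kappa>"
    by (simp add: ext_bracket_def fun_eq_iff prod_eq_iff fst snd)
  ultimately show thesis
    by (rule that)
qed

text \<open>The bracket of two exact forms is exact, by \<open>fbr_kd\<close>, so conditions (2) and
  (3) restrict to exact forms.\<close>

lemma infinitesimal_triple_of_triple:
  assumes "(b, D, K) \<in> poisson_triples alt s br act"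
  shows "infinitesimal_triple b (\<lambda>f. D (d f)) (\<lambda>f g. K (d f) (d g))"
proof -
  note t = assms [unfolded poisson_triples_iff]
  have D: "contravariant D" and K: "form_pairing K"
    using t by auto
  have "derivation_family (\<lambda>f. D (d f))"
    by (simp add: derivation_family_def kd_eq contravariantD [OF D])
  moreover have "skew_biderivation (\<lambda>f g. K (d f) (d g))"
    using K unfolding form_pairing_def
    by (simp add: skew_biderivation_def kd_eq)
  ultimately show ?thesis
    using t unfolding infinitesimal_triple_def by (simp add: fbr_kd [symmetric])
qed

section \<open>Extension from exact forms to all forms\<close>

lemma contravariant_eqI:
  assumes D: "contravariant D" "contravariant D'" and eq: "\<And>f \<eta>. D (d f) \<eta> = D' (d f) \<eta>"
  shows "D = D'"
proof (rule extensionalityI)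
  show "D \<in> extensional \<Omega>" "D' \<in> extensional \<Omega>"
    using D by (auto simp: contravariant_def)
  show "D \<alpha> = D' \<alpha>" if "\<alpha> \<in> \<Omega>" for \<alpha>
    using that
  proof (induction rule: Omega_induct)
    case (madd \<alpha> \<beta>)
    then show ?case by (simp add: fun_eq_iff contravariantD(2) [OF D(1)] contravariantD(2) [OF D(2)])
  next
    case (mscale f \<alpha>)
    then show ?case by (simp add: fun_eq_iff contravariantD(3) [OF D(1)] contravariantD(3) [OF D(2)])
  qed (simp add: eq fun_eq_iff)
qed

lemma form_pairing_eqI:
  assumes K: "form_pairing K" "form_pairing K'" and eq: "\<And>f g. K (d f) (d g) = K' (d f) (d g)"
  shows "K = K'"
proof (rule extensionalityI)
  show "K \<in> extensional \<Omega>" "K' \<in> extensional \<Omega>"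
    using K by (auto simp: form_pairing_def PiE_def)
  fix \<alpha> assume \<alpha>: "\<alpha> \<in> \<Omega>"
  show "K \<alpha> = K' \<alpha>"
  proof (rule extensionalityI)
    show "K \<alpha> \<in> extensional \<Omega>" "K' \<alpha> \<in> extensional \<Omega>"
      using K \<alpha> by (auto simp: form_pairing_def PiE_def)
    fix \<beta> assume "\<beta> \<in> \<Omega>"
    with \<alpha> show "K \<alpha> \<beta> = K' \<alpha> \<beta>"
    proof (induction rule: Omega_induct2)
      case (sym \<alpha> \<beta>)
      then show ?case
        using form_pairingD(3) [OF K(1), of \<alpha> \<beta>] form_pairingD(3) [OF K(2), of \<alpha> \<beta>] by simp
    next
      case (madd \<alpha> \<beta> \<gamma>)
      then show ?case by (simp add: form_pairingD(1) [OF K(1)] form_pairingD(1) [OF K(2)])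
    next
      case (mscale f \<alpha> \<beta>)
      then show ?case by (simp add: form_pairingD(2) [OF K(1)] form_pairingD(2) [OF K(2)])
    qed (rule eq)
  qed
qed

text \<open>For each \<xi> the derivation \<open>\<lambda>f. \<delta> f \<xi>\<close> lifts to a
  linear map on \<Omega>.\<close>

lemma contravariant_extension:
  assumes "derivation_family \<delta>"
  obtains D where "contravariant D" "\<And>f \<eta>. D (d f) \<eta> = \<delta> f \<eta>"
proof -
  note \<delta> = derivation_familyD [OF assms]
  interpret L: module_derivation s act "\<lambda>f. \<delta> f \<xi>" for \<xi>
    by unfold_locales (fact \<delta>)+
  define D where "D = (\<lambda>\<alpha>\<in>\<Omega>. \<lambda>\<xi>. L.form_lift \<xi> \<alpha>)"
  have D: "D \<alpha> \<xi> = L.form_lift \<xi> \<alpha>" if "\<alpha> \<in> \<Omega>" for \<alpha> \<xi>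
    using that by (simp add: D_def)
  have D_kd: "D (d f) \<xi> = \<delta> f \<xi>" for f \<xi>
    by (simp add: D L.form_lift_kd)
  \<comment> \<open>The lift is made for one vector at a time, so its behaviour in the vector has to
    be carried over from exact forms.\<close>
  have "D \<alpha> (\<eta> + \<xi>) = D \<alpha> \<eta> + D \<alpha> \<xi> \<and> D \<alpha> (act f \<eta>) = act f (D \<alpha> \<eta>) + act (\<rho> \<alpha> f) \<eta>"
    if "\<alpha> \<in> \<Omega>" for \<alpha> \<eta> \<xi> f
    using that
  proof (induction rule: Omega_induct)
    case (kd g)
    show ?case by (simp add: D_kd \<delta>(4,5))
  next
    case (madd \<alpha> \<beta>)
    then show ?case by (simp add: D L.form_lift_madd M.scale_right_distrib M.scale_left_distrib add_ac)
  next
    case (mscale g \<alpha>)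
    then show ?case by (simp add: D L.form_lift_mscale M.scale_right_distrib mult.commute)
  qed
  then have "contravariant D"
    by (simp add: contravariant_def D L.form_lift_madd L.form_lift_mscale) (simp add: D_def)
  then show thesis
    by (rule that) (rule D_kd)
qed

text \<open>Two lifts in succession: in the second argument for a fixed \<open>f\<close>, and then
  in the first, once the lifted map is seen to be again a derivation in \<open>f\<close>.\<close>

lemma form_pairing_extension:
  assumes "skew_biderivation \<kappa>"
  obtains K where "form_pairing K" "\<And>f g. K (d f) (d g) = \<kappa> f g"
proof -
  note \<kappa> = skew_biderivationD [OF assms]
  interpret L: module_derivation s act "\<lambda>g. \<kappa> f g" for f
    by unfold_locales (fact \<kappa>)+
  have lift: "L.form_lift (f + g) \<beta> = L.form_lift f \<beta> + L.form_lift g \<beta> \<and>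
      L.form_lift (f * g) \<beta> = act f (L.form_lift g \<beta>) + act g (L.form_lift f \<beta>) \<and>
      L.form_lift (s r f) \<beta> = act (s r 1) (L.form_lift f \<beta>)" if "\<beta> \<in> \<Omega>" for f g r \<beta>
    using that
  proof (induction rule: Omega_induct)
    case (kd h)
    show ?case by (simp add: L.form_lift_kd \<kappa>(4) [of _ h] \<kappa>(1-3))
  next
    case (madd \<alpha> \<beta>)
    then show ?case by (simp add: L.form_lift_madd M.scale_right_distrib add_ac)
  next
    case (mscale h \<alpha>)
    then show ?case by (simp add: L.form_lift_mscale M.scale_right_distrib mult.commute mult.left_commute)
  qed
  have LL: "module_derivation s act (\<lambda>f. L.form_lift f \<beta>)" if "\<beta> \<in> \<Omega>" for \<beta>
    using lift [OF that] by unfold_locales auto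
  define K where "K = (\<lambda>\<alpha>\<in>\<Omega>. \<lambda>\<beta>\<in>\<Omega>. module_derivation.form_lift act (\<lambda>f. L.form_lift f \<beta>) \<alpha>)"
  have K: "K \<alpha> \<beta> = module_derivation.form_lift act (\<lambda>f. L.form_lift f \<beta>) \<alpha>"
    if "\<alpha> \<in> \<Omega>" "\<beta> \<in> \<Omega>" for \<alpha> \<beta>
    using that by (simp add: K_def)
  have K_kd: "K (d f) \<beta> = L.form_lift f \<beta>" if "\<beta> \<in> \<Omega>" for f \<beta>
    using that by (simp add: K module_derivation.form_lift_kd [OF LL])
  have left: "K (\<alpha> \<oplus> \<beta>) \<gamma> = K \<alpha> \<gamma> + K \<beta> \<gamma>" "K (f \<odot> \<alpha>) \<gamma> = act f (K \<alpha> \<gamma>)"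
    if "\<alpha> \<in> \<Omega>" "\<beta> \<in> \<Omega>" "\<gamma> \<in> \<Omega>" for \<alpha> \<beta> \<gamma> f
    using that by (simp_all add: K module_derivation.form_lift_madd [OF LL] module_derivation.form_lift_mscale [OF LL])
  have right: "K \<alpha> (\<beta> \<oplus> \<gamma>) = K \<alpha> \<beta> + K \<alpha> \<gamma> \<and> K \<alpha> (f \<odot> \<beta>) = act f (K \<alpha> \<beta>)"
    if "\<alpha> \<in> \<Omega>" "\<beta> \<in> \<Omega>" "\<gamma> \<in> \<Omega>" for \<alpha> \<beta> \<gamma> f
    using that
  proof (induction rule: Omega_induct)
    case (kd g)
    then show ?case by (simp add: K_kd L.form_lift_madd L.form_lift_mscale)
  next
    case (madd \<alpha> \<alpha>')
    then show ?case by (simp add: left M.scale_right_distrib)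
  next
    case (mscale g \<alpha>)
    then show ?case by (simp add: left M.scale_right_distrib mult.commute)
  qed
  have skew: "K \<alpha> \<beta> + K \<beta> \<alpha> = 0" if "\<alpha> \<in> \<Omega>" "\<beta> \<in> \<Omega>" for \<alpha> \<beta>
    using that
  proof (induction rule: Omega_induct2)
    case (sym \<alpha> \<beta>)
    then show ?case by (simp add: add.commute)
  next
    case (kd f g)
    show ?case using \<kappa>(4) [of f g] by (simp add: K_kd L.form_lift_kd)
  next
    case (madd \<alpha> \<beta> \<gamma>)
    show ?case
      using arg_cong2 [OF madd(4,5), of "(+)"] madd(1-3) by (simp add: left right add_ac)
  next
    case (mscale f \<alpha> \<beta>)
    show ?case
      using arg_cong [OF mscale(3), of "act f"] mscale(1,2) by (simp add: left right M.scale_right_distrib)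
  qed
  have "K \<alpha> \<alpha> = 0" if "\<alpha> \<in> \<Omega>" alt for \<alpha>
    using that(1)
  proof (induction rule: Omega_induct)
    case (kd f)
    show ?case using \<kappa>(5) [OF that(2)] by (simp add: K_kd L.form_lift_kd)
  next
    case (madd \<alpha> \<beta>)
    then show ?case using skew [of \<alpha> \<beta>] by (simp add: left right add.commute)
  next
    case (mscale f \<alpha>)
    then show ?case by (simp add: left right)
  qed
  with right skew have "form_pairing K"
    by (auto simp: form_pairing_def) (auto simp: K_def)
  then show thesis
    by (rule that) (simp add: K_kd L.form_lift_kd)
qed

text \<open>Scaling a form by \<open>f\<close> scales each of (1)--(3), because the Leibniz terms
  cancel. In (2), \<open>\<rho>(\<alpha>)(f) D \<beta> \<xi>\<close> arises both from
  \<open>D \<alpha> (f D \<beta> \<xi>)\<close> and from \<open>[\<alpha>, f \<beta>]\<close>. In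
  (3) with \<open>f \<gamma>\<close>, the terms in \<open>\<rho>(\<alpha>)(f)\<close> come from
  \<open>D \<alpha> (K \<beta> (f \<gamma>))\<close> and
  \<open>K \<beta> [f \<gamma>, \<alpha>]\<close>; those in \<open>\<rho>(\<beta>)(f)\<close> cancel
  by the skewness of \<open>K\<close>.\<close>

lemma triple_of_infinitesimal_triple:
  assumes "infinitesimal_triple b \<delta> \<kappa>"
  obtains D K where "(b, D, K) \<in> poisson_triples alt s br act"
    "(\<lambda>f. D (d f)) = \<delta>" "(\<lambda>f g. K (d f) (d g)) = \<kappa>"
proof -
  have "derivation_family \<delta>" "skew_biderivation \<kappa>"
    using assms by (auto simp: infinitesimal_triple_def)
  then obtain D K where D: "contravariant D" and D_kd: "\<And>f \<eta>. D (d f) \<eta> = \<delta> f \<eta>"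
    and K: "form_pairing K" and K_kd: "\<And>f g. K (d f) (d g) = \<kappa> f g"
    using contravariant_extension form_pairing_extension by metis
  have bas: "linear_skew b" and jac: "\<forall>\<eta> \<xi> \<zeta>. b \<eta> (b \<xi> \<zeta>) + (b \<xi> (b \<zeta> \<eta>) + b \<zeta> (b \<eta> \<xi>)) = 0"
    and kd1: "\<And>f \<eta> \<xi>. \<delta> f (b \<eta> \<xi>) - b \<eta> (\<delta> f \<xi>) = b (\<delta> f \<eta>) \<xi>"
    and kd2: "\<And>f g \<xi>. \<delta> f (\<delta> g \<xi>) - \<delta> g (\<delta> f \<xi>) - \<delta> (br f g) \<xi> = b (\<kappa> f g) \<xi>"
    and kd3: "\<And>f g h. (\<delta> f (\<kappa> g h) + \<kappa> f (br g h)) + (\<delta> g (\<kappa> h f) + \<kappa> g (br h f)) +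
      (\<delta> h (\<kappa> f g) + \<kappa> h (br f g)) = 0"
    using assms by (auto simp: infinitesimal_triple_def)
  note b' = linear_skewD(1,2,5,6) [OF bas]
  interpret E: extension_bracket \<Omega> fbr \<zero> b D K
    by (rule extension_bracket_Omega) fact+
  note D' = contravariantD [OF D] E.D_diff
  have D_minus: "D \<alpha> (- \<eta>) = - D \<alpha> \<eta>" if "\<alpha> \<in> \<Omega>" for \<alpha> \<eta>
    using E.D_diff [OF that, of 0 \<eta>] that by simp
  have 1: "D \<alpha> (b \<eta> \<xi>) - b \<eta> (D \<alpha> \<xi>) = b (D \<alpha> \<eta>) \<xi>" if "\<alpha> \<in> \<Omega>" for \<alpha> \<eta> \<xi>
    using that
  proof (induction rule: Omega_induct)
    case (kd f)
    show ?case by (simp add: D_kd kd1)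
  next
    case (madd \<alpha> \<beta>)
    then show ?case by (simp add: D' b' algebra_simps)
  next
    case (mscale f \<alpha>)
    then show ?case by (simp add: D' b' flip: M.scale_right_diff_distrib)
  qed
  have 2: "D \<alpha> (D \<beta> \<xi>) - D \<beta> (D \<alpha> \<xi>) - D (fbr \<alpha> \<beta>) \<xi> = b (K \<alpha> \<beta>) \<xi>"
    if "\<alpha> \<in> \<Omega>" "\<beta> \<in> \<Omega>" for \<alpha> \<beta> \<xi>
    using that
  proof (induction rule: Omega_induct2)
    case (sym \<alpha> \<beta>)
    have "- (D \<alpha> (D \<beta> \<xi>) - D \<beta> (D \<alpha> \<xi>) - D (fbr \<alpha> \<beta>) \<xi>) = b (- K \<alpha> \<beta>) \<xi>"
      using sym(3) E.b_diff(1) [of 0 "K \<alpha> \<beta>" \<xi>] by simp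
    then show ?case
      using sym(1,2) by (simp add: form_pairingD(3) [OF K, of \<beta> \<alpha>] fbr_skew [of \<beta> \<alpha>] D' algebra_simps)
  next
    case (kd f g)
    show ?case by (simp add: D_kd K_kd fbr_kd kd2)
  next
    case (madd \<alpha> \<beta> \<gamma>)
    show ?case
      using arg_cong2 [OF madd(4,5), of "(+)"] madd(1-3)
      by (simp add: D' b' fbr_add_right form_pairingD(1) [OF K] algebra_simps)
  next
    case (mscale f \<alpha> \<beta>)
    show ?case
      using arg_cong [OF mscale(3), of "act f"] mscale(1,2)
      by (simp add: D' b' fbr_scale_right form_pairingD(2) [OF K] algebra_simps)
  qed
  have 3: "(D \<alpha> (K \<beta> \<gamma>) + K \<alpha> (fbr \<beta> \<gamma>)) + (D \<beta> (K \<gamma> \<alpha>) + K \<beta> (fbr \<gamma> \<alpha>)) +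
      (D \<gamma> (K \<alpha> \<beta>) + K \<gamma> (fbr \<alpha> \<beta>)) = 0" if "\<alpha> \<in> \<Omega>" "\<beta> \<in> \<Omega>" "\<gamma> \<in> \<Omega>" for \<alpha> \<beta> \<gamma>
    using that
  proof (induction rule: Omega_induct3)
    case (cyclic \<alpha> \<beta> \<gamma>)
    then show ?case by (simp add: add_ac)
  next
    case (kd f g h)
    show ?case by (simp add: D_kd K_kd fbr_kd kd3)
  next
    case (madd \<alpha> \<beta> \<gamma> \<gamma>')
    show ?case
      using arg_cong2 [OF madd(5,6), of "(+)"] madd(1-4)
      by (simp add: D' fbr_add_right fbr_add_left form_pairingD(1,5) [OF K] algebra_simps)
  next
    case (mscale f \<alpha> \<beta> \<gamma>)
    show ?case
      using arg_cong [OF mscale(4), of "act f"] mscale(1-3)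
      by (simp add: D' fbr_scale_right fbr_scale_left form_pairingD(1,2,5,6) [OF K]
          form_pairingD(3) [OF K, of \<gamma> \<alpha>] form_pairingD(3) [OF K, of \<gamma> \<beta>] D_minus algebra_simps)
  qed
  have "(b, D, K) \<in> poisson_triples alt s br act"
    using bas D K jac 1 2 3 by (simp add: poisson_triples_iff)
  then show thesis
    by (rule that) (simp_all add: fun_eq_iff D_kd K_kd)
qed

section \<open>Poisson structures as Poisson triples\<close>

lemma bij_betw_poisson_of_triple:
  "bij_betw (poisson_of_triple s br) (poisson_triples alt s br act) (ext_poisson_structures alt s br act)"
proof (rule bij_betw_imageI)
  show "inj_on (poisson_of_triple s br) (poisson_triples alt s br act)"
  proof (rule inj_onI)
    fix t t'
    assume "t \<in> poisson_triples alt s br act" "t' \<in> poisson_triples alt s br act"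
      and "poisson_of_triple s br t = poisson_of_triple s br t'"
    moreover obtain b D K b' D' K' where tt': "t = (b, D, K)" "t' = (b', D', K')"
      by (metis prod_cases3)
    ultimately have t: "(b, D, K) \<in> poisson_triples alt s br act" "(b', D', K') \<in> poisson_triples alt s br act"
      and eq: "poisson_of_triple s br (b, D, K) = poisson_of_triple s br (b', D', K')"
      by simp_all
    have D: "contravariant D" "contravariant D'" and K: "form_pairing K" "form_pairing K'"
      and b: "linear_skew b" "linear_skew b'"
      using t by (auto simp: poisson_triples_iff)
    have i: "derivation_family (\<lambda>f. D (d f))" "derivation_family (\<lambda>f. D' (d f))"
      "skew_biderivation (\<lambda>f g. K (d f) (d g))" "skew_biderivation (\<lambda>f g. K' (d f) (d g))"
      using t [THEN infinitesimal_triple_of_triple] by (auto simp: infinitesimal_triple_def)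
    interpret E: extension_bracket UNIV br 0 b "\<lambda>f. D (d f)" "\<lambda>f g. K (d f) (d g)"
      by (rule extension_bracket_UNIV) fact+
    interpret E': extension_bracket UNIV br 0 b' "\<lambda>f. D' (d f)" "\<lambda>f g. K' (d f) (d g)"
      by (rule extension_bracket_UNIV) fact+
    have e: "D (d f) \<xi> - D (d g) \<eta> + K (d f) (d g) + b \<eta> \<xi> =
      D' (d f) \<xi> - D' (d g) \<eta> + K' (d f) (d g) + b' \<eta> \<xi>" for f \<eta> g \<xi>
      using fun_cong [OF fun_cong [OF eq, of "(f, \<eta>)"], of "(g, \<xi>)"]
      by (simp add: poisson_of_triple_def)
    have "b \<eta> \<xi> = b' \<eta> \<xi>" for \<eta> \<xi>
      \<comment> \<open>Zeros single out the terms of the common formula: two vectors give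
        \<open>b\<close>, a function and a vector give \<open>D\<close>, two functions give
        \<open>K\<close>.\<close>
      using e [of 0 \<xi> 0 \<eta>] by (simp add: E.D_zero E'.D_zero E.K_zero E'.K_zero)
    moreover have "D = D'"
      using D
    proof (rule contravariant_eqI)
      show "D (d f) \<xi> = D' (d f) \<xi>" for f \<xi>
        using e [of f \<xi> 0 0] by (simp add: E.D_zero E'.D_zero E.K_zero E'.K_zero)
    qed
    moreover have "K = K'"
      using K
    proof (rule form_pairing_eqI)
      show "K (d f) (d g) = K' (d f) (d g)" for f g
        using e [of f 0 g 0] by simp
    qed
    ultimately show "t = t'"
      by (simp add: tt' fun_eq_iff)
  qed
  show "poisson_of_triple s br ` poisson_triples alt s br act = ext_poisson_structures alt s br act"
  proof (intro equalityI subsetI)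
    fix B assume "B \<in> ext_poisson_structures alt s br act"
    then obtain b \<delta> \<kappa> where t: "infinitesimal_triple b \<delta> \<kappa>" and B: "B = ext_bracket b \<delta> \<kappa>"
      by (rule ext_poisson_structures_cases)
    from t obtain D K where "(b, D, K) \<in> poisson_triples alt s br act"
      "(\<lambda>f. D (d f)) = \<delta>" "(\<lambda>f g. K (d f) (d g)) = \<kappa>"
      by (rule triple_of_infinitesimal_triple)
    then show "B \<in> poisson_of_triple s br ` poisson_triples alt s br act"
      using B poisson_of_triple_eq [of b D K] by force
  qed (auto simp: poisson_of_triple_eq dest!: infinitesimal_triple_of_triple intro!: ext_bracket_poisson)
qed


section \<open>Lie algebroid structures\<close>

abbreviation A :: "('a form \<times> 'm) set" where "A \<equiv> \<Omega> \<times> UNIV"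

lemma algebroid_module_eq:
  "algebroid_module s act =
    \<lparr>carrier = A, madd = (\<lambda>x y. (fst x \<oplus> fst y, snd x + snd y)), mzero = (\<zero>, 0),
     mscale = (\<lambda>f x. (f \<odot> fst x, act f (snd x)))\<rparr>"
  by (simp add: algebroid_module_def direct_sum_def whole_def fun_eq_iff)

lemma Omega_simps [simp]:
  assumes "\<alpha> \<in> \<Omega>"
  shows "0 \<odot> \<alpha> = \<zero>" "\<alpha> \<oplus> \<zero> = \<alpha>"
  using assms by (subst vec_inj [symmetric]; simp)+

lemma fbr_linear:
  assumes "\<alpha> \<in> \<Omega>" "\<beta> \<in> \<Omega>"
  shows "fbr \<alpha> \<beta> \<oplus> fbr \<beta> \<alpha> = \<zero>" "fbr \<alpha> ((s r 1) \<odot> \<beta>) = (s r 1) \<odot> fbr \<alpha> \<beta>"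
    "fbr ((s r 1) \<odot> \<alpha>) \<beta> = (s r 1) \<odot> fbr \<alpha> \<beta>"
  using assms vec_fbr_skew [of \<alpha> \<beta>]
  by (subst vec_inj [symmetric]; simp add: fbr_scale_right fbr_scale_left \<rho>_one)+

text \<open>\<open>A\<close> contains the faithful summand \<open>P_1\<close> as the pairs with zero
  form.\<close>

lemma faithful_algebroid_module: "faithful (algebroid_module s act)"
  unfolding faithful_def
proof (intro allI impI)
  fix a assume "\<forall>x\<in>carrier (algebroid_module s act).
    mscale (algebroid_module s act) a x = mzero (algebroid_module s act)"
  then have "act a \<eta> = 0" for \<eta>
    using Omega_closed(3) by (fastforce simp: algebroid_module_eq)
  then show "a = 0"
    using faithful by (auto simp: faithful_def whole_def)
qed

definition algebroid_part :: "('a form \<Rightarrow> 'm \<Rightarrow> 'a form \<Rightarrow> 'm \<Rightarrow> 'm) \<Rightarrow> bool" where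
  "algebroid_part T \<longleftrightarrow>
    (\<forall>\<alpha>\<in>\<Omega>. \<forall>\<beta>\<in>\<Omega>. \<forall>\<gamma>\<in>\<Omega>. \<forall>\<eta> \<xi> \<zeta>. T \<alpha> \<eta> (\<beta> \<oplus> \<gamma>) (\<xi> + \<zeta>) = T \<alpha> \<eta> \<beta> \<xi> + T \<alpha> \<eta> \<gamma> \<zeta>) \<and>
    (\<forall>\<alpha>\<in>\<Omega>. \<forall>\<beta>\<in>\<Omega>. \<forall>f \<eta> \<xi>. T \<alpha> \<eta> (f \<odot> \<beta>) (act f \<xi>) = act f (T \<alpha> \<eta> \<beta> \<xi>) + act (\<rho> \<alpha> f) \<xi>) \<and>
    (\<forall>\<alpha>\<in>\<Omega>. \<forall>\<beta>\<in>\<Omega>. \<forall>\<eta> \<xi>. T \<alpha> \<eta> \<beta> \<xi> + T \<beta> \<xi> \<alpha> \<eta> = 0) \<and>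
    (alt \<longrightarrow> (\<forall>\<alpha>\<in>\<Omega>. \<forall>\<eta>. T \<alpha> \<eta> \<alpha> \<eta> = 0)) \<and>
    (\<forall>\<alpha>\<in>\<Omega>. \<forall>\<beta>\<in>\<Omega>. \<forall>\<gamma>\<in>\<Omega>. \<forall>\<eta> \<xi> \<zeta>. T \<alpha> \<eta> (fbr \<beta> \<gamma>) (T \<beta> \<xi> \<gamma> \<zeta>) +
      (T \<beta> \<xi> (fbr \<gamma> \<alpha>) (T \<gamma> \<zeta> \<alpha> \<eta>) + T \<gamma> \<zeta> (fbr \<alpha> \<beta>) (T \<alpha> \<eta> \<beta> \<xi>)) = 0)"

lemma algebroid_partD:
  assumes "algebroid_part T" "\<alpha> \<in> \<Omega>" "\<beta> \<in> \<Omega>"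
  shows "\<gamma> \<in> \<Omega> \<Longrightarrow> T \<alpha> \<eta> (\<beta> \<oplus> \<gamma>) (\<xi> + \<zeta>) = T \<alpha> \<eta> \<beta> \<xi> + T \<alpha> \<eta> \<gamma> \<zeta>"
    "T \<alpha> \<eta> (f \<odot> \<beta>) (act f \<xi>) = act f (T \<alpha> \<eta> \<beta> \<xi>) + act (\<rho> \<alpha> f) \<xi>"
    "T \<alpha> \<eta> \<beta> \<xi> = - T \<beta> \<xi> \<alpha> \<eta>"
    "alt \<Longrightarrow> T \<alpha> \<eta> \<alpha> \<eta> = 0"
    "\<gamma> \<in> \<Omega> \<Longrightarrow> T \<alpha> \<eta> (fbr \<beta> \<gamma>) (T \<beta> \<xi> \<gamma> \<zeta>) +
      (T \<beta> \<xi> (fbr \<gamma> \<alpha>) (T \<gamma> \<zeta> \<alpha> \<eta>) + T \<gamma> \<zeta> (fbr \<alpha> \<beta>) (T \<alpha> \<eta> \<beta> \<xi>)) = 0"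
  using assms(1) [unfolded algebroid_part_def] assms(2,3) by (simp_all add: eq_neg_iff_add_eq_0)

text \<open>With \<open>fbr\<close> as \<Omega>-component, that component of every axiom is a law of
  the Lie algebroid \<Omega>. \<open>R\<close>-linearity of the rest is its Leibniz rule for
  \<open>f = s r 1\<close>, where the anchor term vanishes.\<close>

lemma lie_algebroid_iff:
  assumes B: "\<And>\<alpha> \<beta> \<eta> \<xi>. \<alpha> \<in> \<Omega> \<Longrightarrow> \<beta> \<in> \<Omega> \<Longrightarrow> B (\<alpha>, \<eta>) (\<beta>, \<xi>) = (fbr \<alpha> \<beta>, T \<alpha> \<eta> \<beta> \<xi>)"
  shows "lie_algebroid alt s (algebroid_module s act) B (\<rho> \<circ> fst) \<longleftrightarrow>
    B \<in> A \<rightarrow>\<^sub>E A \<rightarrow>\<^sub>E UNIV \<and> algebroid_part T"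
proof
  assume L: "lie_algebroid alt s (algebroid_module s act) B (\<rho> \<circ> fst)"
  then have lie: "lie_bracket alt (restrict_scalars s (algebroid_module s act)) B"
    and leibniz: "\<And>\<alpha> \<eta> \<beta> \<xi> f. \<alpha> \<in> \<Omega> \<Longrightarrow> \<beta> \<in> \<Omega> \<Longrightarrow>
      snd (B (\<alpha>, \<eta>) (f \<odot> \<beta>, act f \<xi>)) = act f (snd (B (\<alpha>, \<eta>) (\<beta>, \<xi>))) + act (\<rho> \<alpha> f) \<xi>"
    by (simp_all add: lie_algebroid_def algebroid_module_eq)
  from lie have bil: "bilinear_map (restrict_scalars s (algebroid_module s act))
        (restrict_scalars s (algebroid_module s act)) (restrict_scalars s (algebroid_module s act)) B"
    and skew: "\<And>\<alpha> \<eta> \<beta> \<xi>. \<alpha> \<in> \<Omega> \<Longrightarrow> \<beta> \<in> \<Omega> \<Longrightarrow>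
      snd (B (\<alpha>, \<eta>) (\<beta>, \<xi>)) + snd (B (\<beta>, \<xi>) (\<alpha>, \<eta>)) = 0"
    and alt: "\<And>\<alpha> \<eta>. alt \<Longrightarrow> \<alpha> \<in> \<Omega> \<Longrightarrow> snd (B (\<alpha>, \<eta>) (\<alpha>, \<eta>)) = 0"
    and jacobi: "\<And>\<alpha> \<eta> \<beta> \<xi> \<gamma> \<zeta>. \<alpha> \<in> \<Omega> \<Longrightarrow> \<beta> \<in> \<Omega> \<Longrightarrow> \<gamma> \<in> \<Omega> \<Longrightarrow>
      snd (B (\<alpha>, \<eta>) (B (\<beta>, \<xi>) (\<gamma>, \<zeta>))) +
      (snd (B (\<beta>, \<xi>) (B (\<gamma>, \<zeta>) (\<alpha>, \<eta>))) + snd (B (\<gamma>, \<zeta>) (B (\<alpha>, \<eta>) (\<beta>, \<xi>)))) = 0"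
    by (simp_all add: lie_bracket_def skew_symmetric_def algebroid_module_eq restrict_scalars_def)
  from bil have ext: "B \<in> A \<rightarrow>\<^sub>E A \<rightarrow>\<^sub>E A"
    and add: "\<And>\<alpha> \<eta> \<beta> \<xi> \<gamma> \<zeta>. \<alpha> \<in> \<Omega> \<Longrightarrow> \<beta> \<in> \<Omega> \<Longrightarrow> \<gamma> \<in> \<Omega> \<Longrightarrow>
      snd (B (\<alpha>, \<eta>) (\<beta> \<oplus> \<gamma>, \<xi> + \<zeta>)) = snd (B (\<alpha>, \<eta>) (\<beta>, \<xi>)) + snd (B (\<alpha>, \<eta>) (\<gamma>, \<zeta>))"
    by (simp_all add: bilinear_map_def linear_map_def algebroid_module_eq restrict_scalars_def)
  have "algebroid_part T"
    unfolding algebroid_part_def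
  proof (intro conjI ballI allI impI)
    fix \<alpha> \<beta> \<gamma> \<eta> \<xi> \<zeta> f assume "\<alpha> \<in> \<Omega>" "\<beta> \<in> \<Omega>" "\<gamma> \<in> \<Omega>"
    then show "T \<alpha> \<eta> (\<beta> \<oplus> \<gamma>) (\<xi> + \<zeta>) = T \<alpha> \<eta> \<beta> \<xi> + T \<alpha> \<eta> \<gamma> \<zeta>"
      "T \<alpha> \<eta> (fbr \<beta> \<gamma>) (T \<beta> \<xi> \<gamma> \<zeta>) +
        (T \<beta> \<xi> (fbr \<gamma> \<alpha>) (T \<gamma> \<zeta> \<alpha> \<eta>) + T \<gamma> \<zeta> (fbr \<alpha> \<beta>) (T \<alpha> \<eta> \<beta> \<xi>)) = 0"
      using add [of \<alpha> \<beta> \<gamma> \<eta> \<xi> \<zeta>] jacobi [of \<alpha> \<beta> \<gamma> \<eta> \<xi> \<zeta>]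
      by (simp_all add: B)
  next
    fix \<alpha> \<beta> \<eta> \<xi> f assume "\<alpha> \<in> \<Omega>" "\<beta> \<in> \<Omega>"
    then show "T \<alpha> \<eta> (f \<odot> \<beta>) (act f \<xi>) = act f (T \<alpha> \<eta> \<beta> \<xi>) + act (\<rho> \<alpha> f) \<xi>"
      "T \<alpha> \<eta> \<beta> \<xi> + T \<beta> \<xi> \<alpha> \<eta> = 0"
      using leibniz [of \<alpha> \<beta> \<eta> f \<xi>] skew [of \<alpha> \<beta> \<eta> \<xi>] by (simp_all add: B)
  next
    fix \<alpha> \<eta> assume "alt" "\<alpha> \<in> \<Omega>"
    then show "T \<alpha> \<eta> \<alpha> \<eta> = 0"
      using alt [of \<alpha> \<eta>] by (simp add: B)
  qed
  with ext show "B \<in> A \<rightarrow>\<^sub>E A \<rightarrow>\<^sub>E UNIV \<and> algebroid_part T"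
    by (auto simp: PiE_def)
next
  assume "B \<in> A \<rightarrow>\<^sub>E A \<rightarrow>\<^sub>E UNIV \<and> algebroid_part T"
  then have ext: "B \<in> A \<rightarrow>\<^sub>E A \<rightarrow>\<^sub>E UNIV" and T: "algebroid_part T"
    by auto
  note T' = algebroid_partD [OF T]
  have left: "T (\<alpha> \<oplus> \<beta>) (\<eta> + \<xi>) \<gamma> \<zeta> = T \<alpha> \<eta> \<gamma> \<zeta> + T \<beta> \<xi> \<gamma> \<zeta>"
    "T (f \<odot> \<alpha>) (act f \<eta>) \<gamma> \<zeta> = act f (T \<alpha> \<eta> \<gamma> \<zeta>) - act (\<rho> \<gamma> f) \<eta>"
    if "\<alpha> \<in> \<Omega>" "\<beta> \<in> \<Omega>" "\<gamma> \<in> \<Omega>" for \<alpha> \<beta> \<gamma> \<eta> \<xi> \<zeta> f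
    using that T'(3) [of "\<alpha> \<oplus> \<beta>" \<gamma> "\<eta> + \<xi>" \<zeta>] T'(3) [of "f \<odot> \<alpha>" \<gamma> "act f \<eta>" \<zeta>]
      T'(3) [of \<alpha> \<gamma> \<eta> \<zeta>] T'(3) [of \<beta> \<gamma> \<xi> \<zeta>] by (simp_all add: T'(1,2))
  have "B \<in> A \<rightarrow>\<^sub>E A \<rightarrow>\<^sub>E A"
    using ext B by (auto simp: PiE_def Pi_def)
  then have "bilinear_map (restrict_scalars s (algebroid_module s act))
      (restrict_scalars s (algebroid_module s act)) (restrict_scalars s (algebroid_module s act)) B"
    by (auto simp: bilinear_map_def linear_map_def algebroid_module_eq restrict_scalars_def B
        fbr_add_left fbr_add_right fbr_linear T'(1,2) left \<rho>_one)
  moreover have "skew_symmetric alt (restrict_scalars s (algebroid_module s act))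
      (restrict_scalars s (algebroid_module s act)) B"
    using T [unfolded algebroid_part_def]
    by (auto simp: skew_symmetric_def algebroid_module_eq restrict_scalars_def B fbr_linear fbr_alt)
  moreover have "linear_map (algebroid_module s act) (Der s) (\<rho> \<circ> fst)"
    by (auto simp: linear_map_def algebroid_module_eq) (simp_all add: Der_def)
  ultimately show "lie_algebroid alt s (algebroid_module s act) B (\<rho> \<circ> fst)"
    unfolding lie_algebroid_def lie_bracket_def using faithful_algebroid_module
    by (auto simp: algebroid_module_eq restrict_scalars_def B fbr_jacobi fbr_scale_right T'(2,5))
qed

lemma algebroid_part_of_triple:
  assumes "(b, D, K) \<in> poisson_triples alt s br act"
  shows "algebroid_part (ext_snd b D K)"
proof -
  note t = assms [unfolded poisson_triples_iff]
  have b: "linear_skew b" and D: "contravariant D" and K: "form_pairing K"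
    using t by auto
  interpret E: extension_bracket \<Omega> fbr \<zero> b D K
    by (rule extension_bracket_Omega) fact+
  show ?thesis
    unfolding algebroid_part_def
  proof (intro conjI)
    show "\<forall>\<alpha>\<in>\<Omega>. \<forall>\<beta>\<in>\<Omega>. \<forall>\<eta> \<xi>. E.e \<alpha> \<eta> \<beta> \<xi> + E.e \<beta> \<xi> \<alpha> \<eta> = 0"
    proof (intro allI ballI)
      fix \<alpha> \<beta> \<eta> \<xi> assume "\<alpha> \<in> \<Omega>" "\<beta> \<in> \<Omega>"
      then show "E.e \<alpha> \<eta> \<beta> \<xi> + E.e \<beta> \<xi> \<alpha> \<eta> = 0"
        using linear_skewD(3) [OF b, of \<eta> \<xi>] form_pairingD(3) [OF K, of \<alpha> \<beta>] by (simp add: ext_snd_def)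
    qed
    show "\<forall>\<alpha>\<in>\<Omega>. \<forall>\<beta>\<in>\<Omega>. \<forall>\<gamma>\<in>\<Omega>. \<forall>\<eta> \<xi> \<zeta>. E.e \<alpha> \<eta> (fbr \<beta> \<gamma>) (E.e \<beta> \<xi> \<gamma> \<zeta>) +
      (E.e \<beta> \<xi> (fbr \<gamma> \<alpha>) (E.e \<gamma> \<zeta> \<alpha> \<eta>) + E.e \<gamma> \<zeta> (fbr \<alpha> \<beta>) (E.e \<alpha> \<eta> \<beta> \<xi>)) = 0"
      unfolding E.jacobi_iff using t by (elim conjE) (intro conjI; assumption)
  qed (use linear_skewD(4) [OF b] form_pairingD(4) [OF K] in
      \<open>auto simp: ext_snd_def linear_skewD(1,2) [OF b] contravariantD [OF D] form_pairingD(1,2) [OF K]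
        algebra_simps\<close>)
qed

text \<open>The arguments run over \<Omega> already, so the triple consists of the restrictions of
  \<open>T\<close> to the summands and nothing has to be lifted.\<close>

lemma triple_of_algebroid_part:
  assumes T: "algebroid_part T"
  obtains b D K where "(b, D, K) \<in> poisson_triples alt s br act"
    "\<forall>\<alpha>\<in>\<Omega>. \<forall>\<beta>\<in>\<Omega>. \<forall>\<eta> \<xi>. T \<alpha> \<eta> \<beta> \<xi> = ext_snd b D K \<alpha> \<eta> \<beta> \<xi>"
proof -
  note T' = algebroid_partD [OF T]
  define b where "b \<eta> \<xi> = T \<zero> \<eta> \<zero> \<xi>" for \<eta> \<xi>
  define D where "D = (\<lambda>\<alpha>\<in>\<Omega>. \<lambda>\<xi>. T \<alpha> 0 \<zero> \<xi>)"
  define K where "K = (\<lambda>\<alpha>\<in>\<Omega>. \<lambda>\<beta>\<in>\<Omega>. T \<alpha> 0 \<beta> 0)"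
  have zero: "f \<odot> \<zero> = \<zero>" "\<zero> \<oplus> \<zero> = \<zero>" for f
    by (subst vec_inj [symmetric]; simp)+
  have b: "linear_skew b"
    unfolding linear_skew_def
  proof (intro conjI allI impI)
    fix f \<eta> \<xi> \<zeta>
    show "b \<eta> (\<xi> + \<zeta>) = b \<eta> \<xi> + b \<eta> \<zeta>"
      using T'(1) [of \<zero> \<zero> \<zero>] by (simp add: b_def zero)
    show "b \<eta> (act f \<xi>) = act f (b \<eta> \<xi>)"
      using T'(2) [of \<zero> \<zero> \<eta> f] by (simp add: b_def zero)
    show "b \<eta> \<xi> + b \<xi> \<eta> = 0"
      using T'(3) [of \<zero> \<zero> \<eta> \<xi>] by (simp add: b_def)
    show "b \<eta> \<eta> = 0" if alt
      using T'(4) [of \<zero> \<zero> \<eta>] that by (simp add: b_def)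
  qed
  have D_eq: "D \<alpha> \<xi> = T \<alpha> 0 \<zero> \<xi>" if "\<alpha> \<in> \<Omega>" for \<alpha> \<xi>
    using that by (simp add: D_def)
  have D: "contravariant D"
    unfolding contravariant_def
  proof (intro conjI allI ballI)
    show "D \<in> extensional \<Omega>"
      by (simp add: D_def)
    fix \<alpha> \<beta> f \<eta> \<xi> assume \<alpha>: "\<alpha> \<in> \<Omega>"
    show "D \<alpha> (\<eta> + \<xi>) = D \<alpha> \<eta> + D \<alpha> \<xi>"
      using T'(1) [of \<alpha> \<zero> \<zero> 0 \<eta> \<xi>] \<alpha> by (simp add: D_eq zero)
    show "D (f \<odot> \<alpha>) \<eta> = act f (D \<alpha> \<eta>)"
      \<comment> \<open>After a swap \<alpha> stands in the second place next to the vector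
        \<open>0\<close>, so the Leibniz term vanishes.\<close>
      using T'(2) [of \<zero> \<alpha> \<eta> f 0] T'(3) [of "f \<odot> \<alpha>" \<zero> 0 \<eta>] T'(3) [of \<alpha> \<zero> 0 \<eta>] \<alpha> by (simp add: D_eq)
    show "D \<alpha> (act f \<eta>) = act f (D \<alpha> \<eta>) + act (\<rho> \<alpha> f) \<eta>"
      using T'(2) [of \<alpha> \<zero> 0 f \<eta>] \<alpha> by (simp add: D_eq zero)
    assume "\<beta> \<in> \<Omega>"
    then show "D (\<alpha> \<oplus> \<beta>) \<eta> = D \<alpha> \<eta> + D \<beta> \<eta>"
      using T'(1) [of \<zero> \<alpha> \<beta> \<eta> 0 0] T'(3) [of "\<alpha> \<oplus> \<beta>" \<zero> 0 \<eta>] T'(3) [of \<alpha> \<zero> 0 \<eta>] T'(3) [of \<beta> \<zero> 0 \<eta>] \<alpha>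
      by (simp add: D_eq)
  qed
  have K_eq: "K \<alpha> \<beta> = T \<alpha> 0 \<beta> 0" if "\<alpha> \<in> \<Omega>" "\<beta> \<in> \<Omega>" for \<alpha> \<beta>
    using that by (simp add: K_def)
  have K: "form_pairing K"
    unfolding form_pairing_def
  proof (intro conjI allI ballI impI)
    show "K \<in> \<Omega> \<rightarrow>\<^sub>E \<Omega> \<rightarrow>\<^sub>E UNIV"
      by (auto simp: K_def)
    fix \<alpha> assume \<alpha>: "\<alpha> \<in> \<Omega>"
    show "K \<alpha> \<alpha> = 0" if alt
      using T'(4) [OF \<alpha> \<alpha>] that \<alpha> by (simp add: K_eq)
    fix \<beta> f assume \<beta>: "\<beta> \<in> \<Omega>"
    show "K \<alpha> (f \<odot> \<beta>) = act f (K \<alpha> \<beta>)"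
      using T'(2) [OF \<alpha> \<beta>, of 0 f 0] \<alpha> \<beta> by (simp add: K_eq)
    show "K \<alpha> \<beta> + K \<beta> \<alpha> = 0"
      using T'(3) [OF \<alpha> \<beta>, of 0 0] \<alpha> \<beta> by (simp add: K_eq)
    fix \<gamma> assume "\<gamma> \<in> \<Omega>"
    then show "K \<alpha> (\<beta> \<oplus> \<gamma>) = K \<alpha> \<beta> + K \<alpha> \<gamma>"
      using T'(1) [OF \<alpha> \<beta>, of \<gamma> 0 0 0] \<alpha> \<beta> by (simp add: K_eq)
  qed
  have T_eq: "T \<alpha> \<eta> \<beta> \<xi> = ext_snd b D K \<alpha> \<eta> \<beta> \<xi>" if \<Omega>: "\<alpha> \<in> \<Omega>" "\<beta> \<in> \<Omega>" for \<alpha> \<eta> \<beta> \<xi>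
  proof -
    have "T \<alpha> \<eta> \<beta> \<xi> = - T \<beta> 0 \<alpha> \<eta> - T \<zero> \<xi> \<alpha> \<eta>"
      using T'(1) [of \<alpha> \<beta> \<zero> \<eta> 0 \<xi>] T'(3) [of \<alpha> \<beta> \<eta> 0] T'(3) [of \<alpha> \<zero> \<eta> \<xi>] \<Omega> by simp
    also have "\<dots> = - (T \<beta> 0 \<alpha> 0 + T \<beta> 0 \<zero> \<eta>) - (T \<zero> \<xi> \<alpha> 0 + T \<zero> \<xi> \<zero> \<eta>)"
      using T'(1) [of \<beta> \<alpha> \<zero> 0 0 \<eta>] T'(1) [of \<zero> \<alpha> \<zero> \<xi> 0 \<eta>] \<Omega> by simp
    finally show ?thesis
      using T'(3) [of \<beta> \<alpha> 0 0] T'(3) [of \<zero> \<alpha> \<xi> 0] T'(3) [of \<zero> \<zero> \<xi> \<eta>] \<Omega>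
      by (simp add: ext_snd_def b_def D_eq K_eq)
  qed
  interpret E: extension_bracket \<Omega> fbr \<zero> b D K
    by (rule extension_bracket_Omega) fact+
  have "\<forall>\<alpha>\<in>\<Omega>. \<forall>\<beta>\<in>\<Omega>. \<forall>\<gamma>\<in>\<Omega>. \<forall>\<eta> \<xi> \<zeta>. E.e \<alpha> \<eta> (fbr \<beta> \<gamma>) (E.e \<beta> \<xi> \<gamma> \<zeta>) +
      (E.e \<beta> \<xi> (fbr \<gamma> \<alpha>) (E.e \<gamma> \<zeta> \<alpha> \<eta>) + E.e \<gamma> \<zeta> (fbr \<alpha> \<beta>) (E.e \<alpha> \<eta> \<beta> \<xi>)) = 0"
    using T'(5) by (simp add: T_eq)
  then have "(b, D, K) \<in> poisson_triples alt s br act"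
    using b D K unfolding E.jacobi_iff poisson_triples_iff by blast
  then show thesis
    by (rule that) (blast intro: T_eq)
qed

lemma algebroid_of_triple_eq:
  "algebroid_of_triple s br act (b, D, K) =
    (\<lambda>x\<in>A. \<lambda>y\<in>A. (fbr (fst x) (fst y), ext_snd b D K (fst x) (snd x) (fst y) (snd y)), \<rho> \<circ> fst)"
  by (simp add: algebroid_of_triple_def algebroid_module_eq ext_snd_def)

lemma bij_betw_algebroid_of_triple:
  "bij_betw (algebroid_of_triple s br act) (poisson_triples alt s br act) (ext_lie_algebroids alt s br act)"
proof (rule bij_betw_imageI)
  show "inj_on (algebroid_of_triple s br act) (poisson_triples alt s br act)"
  proof (rule inj_onI)
    fix t t'
    assume "t \<in> poisson_triples alt s br act" "t' \<in> poisson_triples alt s br act"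
      and "algebroid_of_triple s br act t = algebroid_of_triple s br act t'"
    moreover obtain b D K b' D' K' where tt': "t = (b, D, K)" "t' = (b', D', K')"
      by (metis prod_cases3)
    ultimately have t: "(b, D, K) \<in> poisson_triples alt s br act" "(b', D', K') \<in> poisson_triples alt s br act"
      and eq: "algebroid_of_triple s br act (b, D, K) = algebroid_of_triple s br act (b', D', K')"
      by simp_all
    have D: "contravariant D" "contravariant D'" and K: "form_pairing K" "form_pairing K'"
      and b: "linear_skew b" "linear_skew b'"
      using t by (auto simp: poisson_triples_iff)
    interpret E: extension_bracket \<Omega> fbr \<zero> b D K
      by (rule extension_bracket_Omega) fact+
    interpret E': extension_bracket \<Omega> fbr \<zero> b' D' K'
      by (rule extension_bracket_Omega) fact+
    have e: "ext_snd b D K \<alpha> \<eta> \<beta> \<xi> = ext_snd b' D' K' \<alpha> \<eta> \<beta> \<xi>"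
      if "\<alpha> \<in> \<Omega>" "\<beta> \<in> \<Omega>" for \<alpha> \<eta> \<beta> \<xi>
      using fun_cong [OF fun_cong [OF arg_cong [OF eq, of fst], of "(\<alpha>, \<eta>)"], of "(\<beta>, \<xi>)"] that
      by (simp add: algebroid_of_triple_eq)
    have "b \<eta> \<xi> = b' \<eta> \<xi>" for \<eta> \<xi>
      using e [of \<zero> \<zero> \<eta> \<xi>] by (simp add: ext_snd_def E.D_zero E'.D_zero E.K_zero E'.K_zero)
    moreover have "D = D'"
      using D
    proof (rule contravariant_eqI)
      show "D (d f) \<xi> = D' (d f) \<xi>" for f \<xi>
        using e [of "d f" \<zero> 0 \<xi>] by (simp add: ext_snd_def E.D_zero E'.D_zero E.K_zero E'.K_zero)
    qed
    moreover have "K = K'"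
      using K
    proof (rule form_pairing_eqI)
      show "K (d f) (d g) = K' (d f) (d g)" for f g
        using e [of "d f" "d g" 0 0] by (simp add: ext_snd_def)
    qed
    ultimately show "t = t'"
      by (simp add: tt' fun_eq_iff)
  qed
  show "algebroid_of_triple s br act ` poisson_triples alt s br act = ext_lie_algebroids alt s br act"
  proof (intro equalityI subsetI)
    fix x assume "x \<in> algebroid_of_triple s br act ` poisson_triples alt s br act"
    then obtain b D K where t: "(b, D, K) \<in> poisson_triples alt s br act"
      and x: "x = algebroid_of_triple s br act (b, D, K)"
      by auto
    show "x \<in> ext_lie_algebroids alt s br act"
      unfolding x ext_lie_algebroids_def algebroid_of_triple_eq
      using algebroid_part_of_triple [OF t]
      by (auto simp: lie_algebroid_iff [where T = "ext_snd b D K"])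
  next
    fix x assume "x \<in> ext_lie_algebroids alt s br act"
    then obtain B where x: "x = (B, \<rho> \<circ> fst)"
      and L: "lie_algebroid alt s (algebroid_module s act) B (\<rho> \<circ> fst)"
      and fst: "\<And>\<alpha> \<beta> \<eta> \<xi>. \<alpha> \<in> \<Omega> \<Longrightarrow> \<beta> \<in> \<Omega> \<Longrightarrow> fst (B (\<alpha>, \<eta>) (\<beta>, \<xi>)) = fbr \<alpha> \<beta>"
      by (auto simp: ext_lie_algebroids_def)
    have B: "B (\<alpha>, \<eta>) (\<beta>, \<xi>) = (fbr \<alpha> \<beta>, snd (B (\<alpha>, \<eta>) (\<beta>, \<xi>)))" if "\<alpha> \<in> \<Omega>" "\<beta> \<in> \<Omega>" for \<alpha> \<beta> \<eta> \<xi>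
      using fst that by (simp add: prod_eq_iff)
    have "B \<in> A \<rightarrow>\<^sub>E A \<rightarrow>\<^sub>E UNIV \<and> algebroid_part (\<lambda>\<alpha> \<eta> \<beta> \<xi>. snd (B (\<alpha>, \<eta>) (\<beta>, \<xi>)))"
      using L by (subst lie_algebroid_iff [symmetric]) (rule B)
    then have ext: "B \<in> A \<rightarrow>\<^sub>E A \<rightarrow>\<^sub>E UNIV"
      and part: "algebroid_part (\<lambda>\<alpha> \<eta> \<beta> \<xi>. snd (B (\<alpha>, \<eta>) (\<beta>, \<xi>)))"
      by (rule conjunct1, rule conjunct2)
    from part obtain b D K where t: "(b, D, K) \<in> poisson_triples alt s br act"
      and T: "\<forall>\<alpha>\<in>\<Omega>. \<forall>\<beta>\<in>\<Omega>. \<forall>\<eta> \<xi>. snd (B (\<alpha>, \<eta>) (\<beta>, \<xi>)) = ext_snd b D K \<alpha> \<eta> \<beta> \<xi>"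
      by (rule triple_of_algebroid_part)
    \<comment> \<open>An equality of functions on the whole type: outside \<open>A\<close> both take
      the value \<open>undefined\<close>.\<close>
    have "B = (\<lambda>x\<in>A. \<lambda>y\<in>A. (fbr (fst x) (fst y), ext_snd b D K (fst x) (snd x) (fst y) (snd y)))"
    proof (rule extensionalityI)
      show "B \<in> extensional A"
        using ext by (simp add: PiE_def)
      fix x assume x: "x \<in> A"
      show "B x = (\<lambda>x\<in>A. \<lambda>y\<in>A. (fbr (fst x) (fst y), ext_snd b D K (fst x) (snd x) (fst y) (snd y))) x"
      proof (rule extensionalityI)
        show "B x \<in> extensional A"
          using ext x by (auto simp: PiE_def)
        show "(\<lambda>x\<in>A. \<lambda>y\<in>A. (fbr (fst x) (fst y), ext_snd b D K (fst x) (snd x) (fst y) (snd y))) x \<in> extensional A"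
          using x by (simp add: restrict_apply)
        fix y assume "y \<in> A"
        with x show "B x y = (\<lambda>x\<in>A. \<lambda>y\<in>A. (fbr (fst x) (fst y), ext_snd b D K (fst x) (snd x) (fst y) (snd y))) x y"
          by (auto simp: prod_eq_iff fst T)
      qed
    qed simp
    then show "x \<in> algebroid_of_triple s br act ` poisson_triples alt s br act"
      using t by (auto simp: x algebroid_of_triple_eq intro!: rev_image_eqI)
  qed
qed

end

theorem theorem4p3:
  fixes s :: "'r::comm_ring_1 \<Rightarrow> 'a::comm_ring_1 \<Rightarrow> 'a"
    and br :: "'a \<Rightarrow> 'a \<Rightarrow> 'a"
    and act :: "'a \<Rightarrow> 'm::ab_group_add \<Rightarrow> 'm"
    and alt :: bool
  assumes "comm_algebra s"
    and "poisson_structure alt (whole s) (*) br"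
    and "module act"
    and "faithful (whole act)"
  shows "bij_betw (poisson_of_triple s br)
           (poisson_triples alt s br act) (ext_poisson_structures alt s br act) \<and>
         bij_betw (algebroid_of_triple s br act)
           (poisson_triples alt s br act) (ext_lie_algebroids alt s br act)"
proof -
  interpret poisson_extension s alt br act
    by (intro poisson_extension.intro poisson_algebra.intro poisson_algebra_axioms.intro
        poisson_extension_axioms.intro assms)
  show ?thesis
    using bij_betw_poisson_of_triple bij_betw_algebroid_of_triple by blast
qed

end
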